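(* Let $\Bbbk$ be a field of characteristic zero with algebraic closure $\overline{\Bbbk}$. Let $K_1:=K\{p_1(x)xy\}$ and $K_2:=K\{p_2(x)xy\}$ where $p_1(x)$ and $p_2(x)$ are nonzero polynomials in $\Bbbk[x]$. Suppose (a) $\deg p_1(x)\ge2$, and (b) $\deg p_1(x)\ge\deg p_2(x)$. Then ${}^1\Gamma_0(K_1)=\Bbbk[x]$. Now let $\phi:K_1\to K_2$ be a Poisson homomorphism. Then the following hold. (1) $\deg p_1(x)=\deg p_2(x)$. (2) $\phi(x)=\alpha x+\beta$ for some $\alpha\in\Bbbk^\times$ and $\beta\in\Bbbk$. (3) If further $p_2(x)=p_1(x)$ and $p_1(x)$ has a nonzero root in $\overline{\Bbbk}$, then $\phi$ is an automorphism of $K_1$. (4) $\mathrm{vht}_1(K_1)=\mathrm{fht}(K_1)=\deg p_1+2$.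
   Context: For $\mathbf f\in\Bbbk(x,y)$, $K\{\mathbf f\}$ denotes the rational function field $\Bbbk(x,y)$ equipped with the unique ($\Bbbk$-bilinear) Poisson bracket such that $\{x,y\}=\mathbf f$; explicitly $\{g,h\}=\left(\frac{\partial g}{\partial x}\frac{\partial h}{\partial y}-\frac{\partial g}{\partial y}\frac{\partial h}{\partial x}\right)\mathbf f$. A Poisson homomorphism is a $\Bbbk$-algebra homomorphism preserving Poisson brackets. Let $K$ be a Poisson field over $\Bbbk$ and $w\in\mathbb Z$. A $w$-valuation on $K$ is a map $\nu:K\to\mathbb Z\cup\{\infty\}$ such that for all $a,b\in K$: $\nu(a)=\infty$ iff $a=0$; $\nu(ab)=\nu(a)+\nu(b)$; $\nu(a+b)\ge\min(\nu(a),\nu(b))$; $\nu(a)=0$ for $a\in\Bbbk^\times$; and $\nu(\{a,b\})\ge\nu(a)+\nu(b)-w$. It is trivial if $\nu(a)=0$ for all $a\neq0$, and classical if $\nu(\{a,b\})>\nu(a)+\nu(b)-w$ for all nonzero $a,b$. Put $F_0^\nu(K)=\{a\in K\mid\nu(a)\ge0\}$, and for $n\in\mathbb Z$ let ${}^n\Gamma_0(K)=\{a\in K\mid\nu(a)\ge0\text{ for all nontrivial }n\text{-valuations }\nu\text{ on }K\}$ (which is $K$ if there are none). If the bracket on $K$ is nontrivial, the $n$-valuation height is $\mathrm{vht}_n(K)=2+\inf\{w\in\mathbb Z\mid \text{there is a non-classical }w\text{-valuation }\nu\text{ on }K\text{ with }F_0^\nu(K)\cap{}^n\Gamma_0(K)=\Bbbk\}$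 (with $\inf\emptyset=+\infty$, and $-\infty$ allowed). For $K$ of the form $K\{\mathbf f\}$, the flag height $\mathrm{fht}(K)$ is the minimum of the total degrees $\deg\mathbf g$ over $\mathbf g\in\Bbbk[x,y]$ with $K\cong K\{\mathbf g\}$ as Poisson fields, and $\infty$ if no such $\mathbf g$ exists. *)

theory Defs
  imports
    "HOL-Algebra.Algebraic_Closure_Type"
    "HOL-Computational_Algebra.Computational_Algebra"
    "HOL-Library.Extended"
    "HOL-Library.Extended_Real"
begin

section \<open>Poisson fields\<close>

text \<open>The base field is the type \<^typ>\<open>'k\<close>, the Poisson field is the whole type \<^typ>\<open>'a\<close>.\<close>

record ('k, 'a) poisson =
  scal :: "'k \<Rightarrow> 'a"
  brk :: "'a \<Rightarrow> 'a \<Rightarrow> 'a"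

definition poisson_field :: "('k::field, 'a::field) poisson \<Rightarrow> bool" where
  "poisson_field K \<longleftrightarrow>
     scal K 1 = 1 \<and>
     (\<forall>c d. scal K (c + d) = scal K c + scal K d) \<and>
     (\<forall>c d. scal K (c * d) = scal K c * scal K d) \<and>
     (\<forall>a b c. brk K (a + b) c = brk K a c + brk K b c) \<and>
     (\<forall>a b c. brk K a (b + c) = brk K a b + brk K a c) \<and>
     (\<forall>r a b. brk K (scal K r * a) b = scal K r * brk K a b) \<and>
     (\<forall>r a b. brk K a (scal K r * b) = scal K r * brk K a b) \<and>
     (\<forall>a. brk K a a = 0) \<and>
     (\<forall>a b c. brk K a (b * c) = brk K a b * c + b * brk K a c) \<and>
     (\<forall>a b c. brk K a (brk K b c) + brk K b (brk K c a) + brk K c (brk K a b) = 0)"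

definition poisson_hom ::
  "('k::field, 'a::field) poisson \<Rightarrow> ('k, 'b::field) poisson \<Rightarrow> ('a \<Rightarrow> 'b) \<Rightarrow> bool" where
  "poisson_hom K L \<phi> \<longleftrightarrow>
     \<phi> 1 = 1 \<and>
     (\<forall>a b. \<phi> (a + b) = \<phi> a + \<phi> b) \<and>
     (\<forall>a b. \<phi> (a * b) = \<phi> a * \<phi> b) \<and>
     (\<forall>c. \<phi> (scal K c) = scal L c) \<and>
     (\<forall>a b. \<phi> (brk K a b) = brk L (\<phi> a) (\<phi> b))"

definition poisson_iso ::
  "('k::field, 'a::field) poisson \<Rightarrow> ('k, 'b::field) poisson \<Rightarrow> ('a \<Rightarrow> 'b) \<Rightarrow> bool" where
  "poisson_iso K L \<phi> \<longleftrightarrow> poisson_hom K L \<phi> \<and> bij \<phi>"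

definition poisson_isomorphic ::
  "('k::field, 'a::field) poisson \<Rightarrow> ('k, 'b::field) poisson \<Rightarrow> bool" where
  "poisson_isomorphic K L \<longleftrightarrow> (\<exists>\<phi>. poisson_iso K L \<phi>)"


section \<open>Valuations and heights\<close>

text \<open>
  The value set is the integers with a top element. The type \<^typ>\<open>int extended\<close> also has a
  bottom element \<^term>\<open>Minf\<close>, which the first condition excludes.
\<close>

definition w_valuation ::
  "('k::field, 'a::field) poisson \<Rightarrow> int \<Rightarrow> ('a \<Rightarrow> int extended) \<Rightarrow> bool" where
  "w_valuation K w \<nu> \<longleftrightarrow>
     (\<forall>a. \<nu> a \<noteq> Minf) \<and>
     (\<forall>a. \<nu> a = Pinf \<longleftrightarrow> a = 0) \<and>
     (\<forall>a b. \<nu> (a * b) = \<nu> a + \<nu> b) \<and>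
     (\<forall>a b. \<nu> (a + b) \<ge> min (\<nu> a) (\<nu> b)) \<and>
     (\<forall>c. c \<noteq> 0 \<longrightarrow> \<nu> (scal K c) = 0) \<and>
     (\<forall>a b. \<nu> (brk K a b) \<ge> \<nu> a + \<nu> b - Fin w)"

definition trivial_valuation :: "('a::field \<Rightarrow> int extended) \<Rightarrow> bool" where
  "trivial_valuation \<nu> \<longleftrightarrow> (\<forall>a. a \<noteq> 0 \<longrightarrow> \<nu> a = 0)"

definition classical_valuation ::
  "('k::field, 'a::field) poisson \<Rightarrow> int \<Rightarrow> ('a \<Rightarrow> int extended) \<Rightarrow> bool" where
  "classical_valuation K w \<nu> \<longleftrightarrow>
     (\<forall>a b. a \<noteq> 0 \<longrightarrow> b \<noteq> 0 \<longrightarrow> \<nu> (brk K a b) > \<nu> a + \<nu> b - Fin w)"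

definition F0 :: "('a::field \<Rightarrow> int extended) \<Rightarrow> 'a set" where
  "F0 \<nu> = {a. \<nu> a \<ge> 0}"

definition Gamma0 :: "int \<Rightarrow> ('k::field, 'a::field) poisson \<Rightarrow> 'a set" where
  "Gamma0 n K =
     {a. \<forall>\<nu>. w_valuation K n \<nu> \<and> \<not> trivial_valuation \<nu> \<longrightarrow> \<nu> a \<ge> 0}"

text \<open>Only meaningful when the bracket of \<open>K\<close> is nontrivial.\<close>

definition vht :: "int \<Rightarrow> ('k::field, 'a::field) poisson \<Rightarrow> ereal" where
  "vht n K =
     2 + (INF w \<in> {w. \<exists>\<nu>. w_valuation K w \<nu> \<and> \<not> classical_valuation K w \<nu> \<and>
                          F0 \<nu> \<inter> Gamma0 n K = range (scal K)}. ereal (of_int w))"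


section \<open>The rational function field in two variables\<close>

text \<open>
  In \<^typ>\<open>'k poly poly\<close> the variable of the coefficients is \<open>x\<close> and the outer variable
  is \<open>y\<close>.
\<close>

type_synonym 'k ratfun = "'k poly poly fract"

definition rconst :: "'k::field \<Rightarrow> 'k ratfun" where
  "rconst c = to_fract [:[:c:]:]"

definition of_xpoly :: "'k::field poly \<Rightarrow> 'k ratfun" where
  "of_xpoly p = to_fract [:p:]"

definition ratX :: "'k::field ratfun" where
  "ratX = to_fract [:[:0, 1:]:]"

definition ratY :: "'k::field ratfun" where
  "ratY = to_fract [:0, 1:]"

text \<open>A derivation extends from an integral domain to its fraction field by the quotient rule.\<close>

lemma quotient_rule_respects:
  fixes D :: "'a::idom \<Rightarrow> 'a"
  assumes D: "\<And>a b. D (a * b) = D a * b + a * D b"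
    and eq: "a * d = c * b"
  shows "(D a * b - a * D b) * (d * d) = (D c * d - c * D d) * (b * b)"
proof -
  have 1: "D a * d = D c * b + c * D b - a * D d"
    using D[of a d] D[of c b] eq by (simp add: algebra_simps)
  have "(D a * b - a * D b) * (d * d) = b * d * (D a * d) - (a * d) * d * D b"
    by (simp add: algebra_simps)
  also have "\<dots> = b * d * (D c * b + c * D b - a * D d) - (c * b) * d * D b"
    unfolding eq 1 ..
  also have "\<dots> = b * d * D c * b - b * (a * d) * D d"
    by (simp add: algebra_simps)
  also have "\<dots> = (D c * d - c * D d) * (b * b)"
    unfolding eq by (simp add: algebra_simps)
  finally show ?thesis .
qed

lemma pderiv_prod_rule: "pderiv (p * q) = pderiv p * q + p * pderiv q"
  by (simp add: pderiv_mult algebra_simps)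

lemma map_pderiv_add: "map_poly pderiv (p + q) = map_poly pderiv p + map_poly pderiv q"
  by (rule poly_eqI) (simp add: coeff_map_poly pderiv_add)

lemma map_pderiv_prod_rule:
  "map_poly pderiv (p * q) = map_poly pderiv p * q + p * map_poly pderiv q"
proof (induction p)
  case (pCons a p)
  have smult: "map_poly pderiv (smult a q) = smult (pderiv a) q + smult a (map_poly pderiv q)"
    by (rule poly_eqI) (simp add: coeff_map_poly pderiv_prod_rule)
  have pc: "map_poly pderiv (pCons b r) = pCons (pderiv b) (map_poly pderiv r)" for b r
    by (rule poly_eqI) (simp add: coeff_map_poly coeff_pCons split: nat.splits)
  show ?case
    by (simp add: map_pderiv_add smult pc pCons.IH algebra_simps)
qed simp

definition fract_deriv :: "('a::idom \<Rightarrow> 'a) \<Rightarrow> 'a fract \<Rightarrow> 'a fract" where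
  "fract_deriv D q =
     (THE r. \<forall>a b. b \<noteq> 0 \<longrightarrow> q = Fract a b \<longrightarrow> r = Fract (D a * b - a * D b) (b * b))"

lemma fract_deriv_Fract:
  assumes D: "\<And>a b. D (a * b) = D a * b + a * D b" and b: "b \<noteq> 0"
  shows "fract_deriv D (Fract a b) = Fract (D a * b - a * D b) (b * b)"
  unfolding fract_deriv_def
proof (rule the_equality)
  show "\<forall>c d. d \<noteq> 0 \<longrightarrow> Fract a b = Fract c d \<longrightarrow>
          Fract (D a * b - a * D b) (b * b) = Fract (D c * d - c * D d) (d * d)"
    using b by (simp add: eq_fract quotient_rule_respects[of D, OF D])
qed (use b in blast)

definition dx :: "'k::field ratfun \<Rightarrow> 'k ratfun" where
  "dx = fract_deriv (map_poly pderiv)"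

definition dy :: "'k::field ratfun \<Rightarrow> 'k ratfun" where
  "dy = fract_deriv pderiv"

text \<open>The Poisson field \<open>K{f}\<close>, with \<open>{x, y} = f\<close>.\<close>

definition KP :: "'k::field ratfun \<Rightarrow> ('k, 'k ratfun) poisson" where
  "KP f = \<lparr>scal = rconst, brk = (\<lambda>g h. (dx g * dy h - dy g * dx h) * f)\<rparr>"

text \<open>The zero polynomial gets total degree \<open>0\<close>.\<close>

definition total_degree :: "'k::field poly poly \<Rightarrow> nat" where
  "total_degree g =
     Max (insert 0 {i + j | i j. Polynomial.coeff (Polynomial.coeff g j) i \<noteq> 0})"

text \<open>The infimum of the empty set in \<^typ>\<open>enat\<close> is infinity.\<close>

definition fht :: "('k::field, 'a::field) poisson \<Rightarrow> enat" where
  "fht K = (INF g \<in> {g :: 'k poly poly. poisson_isomorphic K (KP (to_fract g))}.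
              enat (total_degree g))"


section \<open>Consistency of the definitions\<close>

lemma finite_total_degree:
  "finite {i + j | i j. Polynomial.coeff (Polynomial.coeff g j) i \<noteq> 0}"
proof (rule finite_subset)
  show "{i + j | i j. Polynomial.coeff (Polynomial.coeff g j) i \<noteq> 0} \<subseteq>
    (\<lambda>(i, j). i + j) ` (SIGMA i:{..Max ((\<lambda>j. Polynomial.degree (Polynomial.coeff g j)) ` {..Polynomial.degree g})}.
        {..Polynomial.degree g})"
  proof clarify
    fix i j assume nz: "Polynomial.coeff (Polynomial.coeff g j) i \<noteq> 0"
    have j: "j \<le> Polynomial.degree g"
      using nz by (intro le_degree) auto
    have "i \<le> Polynomial.degree (Polynomial.coeff g j)"
      using nz by (rule le_degree)
    also have "\<dots> \<le> Max ((\<lambda>j. Polynomial.degree (Polynomial.coeff g j)) ` {..Polynomial.degree g})"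
      using j by (intro Max_ge) auto
    finally show "i + j \<in> (\<lambda>(i, j). i + j) ` (SIGMA i:{..Max ((\<lambda>j. Polynomial.degree (Polynomial.coeff g j)) ` {..Polynomial.degree g})}.
        {..Polynomial.degree g})"
      using j by force
  qed
qed auto

lemma dx_Fract:
  "b \<noteq> 0 \<Longrightarrow> dx (Fract a b) = Fract (map_poly pderiv a * b - a * map_poly pderiv b) (b * b)"
  unfolding dx_def by (rule fract_deriv_Fract[OF map_pderiv_prod_rule])

lemma dy_Fract:
  "b \<noteq> 0 \<Longrightarrow> dy (Fract a b) = Fract (pderiv a * b - a * pderiv b) (b * b)"
  unfolding dy_def by (rule fract_deriv_Fract[OF pderiv_prod_rule])

lemma dx_add: "dx (g + h) = dx g + dx h"
  by (cases g; cases h)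
    (simp add: dx_Fract eq_fract map_pderiv_add map_pderiv_prod_rule, simp add: algebra_simps)

lemma dy_add: "dy (g + h) = dy g + dy h"
  by (cases g; cases h)
    (simp add: dy_Fract eq_fract pderiv_add pderiv_prod_rule, simp add: algebra_simps)

lemma dx_mult: "dx (g * h) = dx g * h + g * dx h"
  by (cases g; cases h)
    (simp add: dx_Fract eq_fract map_pderiv_prod_rule, simp add: algebra_simps)

lemma dy_mult: "dy (g * h) = dy g * h + g * dy h"
  by (cases g; cases h)
    (simp add: dy_Fract eq_fract pderiv_prod_rule, simp add: algebra_simps)

lemma dx_to_fract: "dx (to_fract p) = to_fract (map_poly pderiv p)"
  by (simp add: to_fract_def dx_Fract one_pCons map_poly_pCons, simp flip: one_pCons)

lemma dy_to_fract: "dy (to_fract p) = to_fract (pderiv p)"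
  by (simp add: to_fract_def dy_Fract)

lemma dx_rconst [simp]: "dx (rconst c) = 0"
  by (simp add: rconst_def dx_to_fract map_poly_pCons)

lemma dy_rconst [simp]: "dy (rconst c) = 0"
  by (simp add: rconst_def dy_to_fract pderiv_pCons)

lemma brk_KP: "brk (KP f) g h = (dx g * dy h - dy g * dx h) * f"
  by (simp add: KP_def)

lemma scal_KP: "scal (KP f) = rconst"
  by (simp add: KP_def)

lemma brk_KP_X_Y: "brk (KP f) ratX ratY = f"
  by (simp add: brk_KP ratX_def ratY_def dx_to_fract dy_to_fract map_poly_pCons pderiv_pCons
      flip: one_pCons)

lemma dx_uminus: "dx (- g) = - dx g"
  using dx_add[of g "- g"] dx_to_fract[of 0] by (metis add.inverse_unique add.right_inverse map_poly_0 pderiv_0 to_fract_0)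

lemma dy_uminus: "dy (- g) = - dy g"
  using dy_add[of g "- g"] dy_to_fract[of 0] by (metis add.inverse_unique add.right_inverse map_poly_0 pderiv_0 to_fract_0)

lemma dx_diff: "dx (g - h) = dx g - dx h"
  using dx_add[of g "- h"] by (simp add: dx_uminus)

lemma dy_diff: "dy (g - h) = dy g - dy h"
  using dy_add[of g "- h"] by (simp add: dy_uminus)

lemma pderiv_map_pderiv: "pderiv (map_poly pderiv p) = map_poly pderiv (pderiv p)"
proof (rule poly_eqI)
  have "pderiv (of_nat n * q) = of_nat n * pderiv q" for n and q :: "'a poly"
    by (induction n) (simp_all add: pderiv_add algebra_simps)
  from this[of "Suc n" for n]
  show "Polynomial.coeff (pderiv (map_poly pderiv p)) n = Polynomial.coeff (map_poly pderiv (pderiv p)) n" for n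
    by (simp add: coeff_map_poly coeff_pderiv del: of_nat_Suc)
qed

lemma dx_dy: "dx (dy g) = dy (dx g)"
proof (cases g)
  case (Fract a b)
  define A B where "A = to_fract a" and "B = to_fract b"
  have B: "B \<noteq> 0" using Fract by (simp add: B_def)
  have g: "A = g * B"
    using Fract by (simp add: A_def B_def to_fract_def eq_fract)
  have c: "dx (dy (to_fract p)) = dy (dx (to_fract p))" for p :: "'a poly poly"
    by (simp add: dx_to_fract dy_to_fract pderiv_map_pderiv)
  have "dx (dy (g * B)) = dy (dx (g * B))"
    using c[of a] g by (simp add: A_def)
  hence "dx (dy g) * B = dy (dx g) * B"
    using c[of b] by (simp add: dx_mult dy_mult dx_add dy_add B_def[symmetric] algebra_simps)
  thus ?thesis using B by simp
qed

lemma rconst_0 [simp]: "rconst 0 = 0" and rconst_1 [simp]: "rconst 1 = 1"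
  by (simp_all add: rconst_def flip: one_pCons)

lemma poisson_field_KP: "poisson_field (KP f)"
  unfolding poisson_field_def brk_KP scal_KP
proof (intro conjI allI)
  show "rconst (c + d) = rconst c + rconst d" for c d :: 'a
    by (simp add: rconst_def flip: to_fract_add)
  show "rconst (c * d) = rconst c * rconst d" for c d :: 'a
    by (simp add: rconst_def flip: to_fract_mult)
qed (simp_all add: dx_add dy_add dx_mult dy_mult dx_diff dy_diff dx_dy, simp_all add: algebra_simps)

end

theory Submission
  imports Defs "Berlekamp_Zassenhaus.Unique_Factorization_Poly"
begin

text \<open>
  If \<open>f\<close> is a polynomial, the order of vanishing along any prime polynomial is a 1-valuation of
  \<open>K{f}\<close>; if \<open>deg\<^sub>y f \<le> 2\<close>, so is the negative \<open>y\<close>-degree. Hence the 1-integral elements of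
  \<open>K{p(x)xy}\<close> lie in \<open>k[x]\<close>. Conversely, evaluating a \<open>w\<close>-valuation at \<open>{x, y} = p(x)xy\<close> shows
  that \<open>\<nu>(x) < 0\<close> forces \<open>w \<ge> deg p\<close>; this also bounds both heights from below, and the negative total
  degree attains the bounds.

  A Poisson homomorphism \<open>\<phi>\<close> preserves 1-integral elements, so \<open>\<phi>(x) = g(x)\<close>. The image of
  \<open>{x, y}\<close> shows that \<open>y \<partial>\<^sub>y \<phi>(y) / \<phi>(y)\<close> does not depend on \<open>y\<close>, so it is an integer \<open>n\<close>, and
  \<open>q\<^sub>1(g) = n g' q\<^sub>2\<close> with \<open>q\<^sub>i = x p\<^sub>i\<close>. Comparing degrees, \<open>g = \<alpha>x + \<beta>\<close>. If \<open>q\<^sub>1 = q\<^sub>2\<close>, then \<open>g\<close>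
  permutes the roots of \<open>q\<^sub>1\<close> and \<open>n = \<alpha>\<^sup>d\<close> with \<open>d = deg p\<^sub>1\<close>. If there are at least two roots, \<open>\<alpha>\<close> and
  therefore \<open>n\<close> is a root of unity, so \<open>n = \<plusminus>1\<close> and \<open>\<phi>(y) = c(x) y\<^sup>n\<close>.
\<close>

section \<open>Integer-valued valuations\<close>

text \<open>Every clause is restricted to nonzero arguments, so the values are plain integers and
  linear arithmetic applies directly. \<open>ext_val\<close> puts the infinite value at zero
  back.\<close>

definition int_valuation :: "('k::field, 'a::field) poisson \<Rightarrow> int \<Rightarrow> ('a \<Rightarrow> int) \<Rightarrow> bool" where
  "int_valuation K w N \<longleftrightarrow>
     (\<forall>a b. a \<noteq> 0 \<longrightarrow> b \<noteq> 0 \<longrightarrow> N (a * b) = N a + N b) \<and>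
     (\<forall>a b. a \<noteq> 0 \<longrightarrow> b \<noteq> 0 \<longrightarrow> a + b \<noteq> 0 \<longrightarrow> min (N a) (N b) \<le> N (a + b)) \<and>
     (\<forall>c. c \<noteq> 0 \<longrightarrow> N (scal K c) = 0) \<and>
     (\<forall>a b. a \<noteq> 0 \<longrightarrow> b \<noteq> 0 \<longrightarrow> brk K a b \<noteq> 0 \<longrightarrow> N a + N b - w \<le> N (brk K a b))"

definition ext_val :: "('a::zero \<Rightarrow> int) \<Rightarrow> 'a \<Rightarrow> int extended" where
  "ext_val N a = (if a = 0 then Pinf else Fin (N a))"

lemma brk_0:
  assumes "poisson_field K"
  shows "brk K 0 b = 0" "brk K b 0 = 0"
proof -
  have "brk K (0 + 0) b = brk K 0 b + brk K 0 b" "brk K b (0 + 0) = brk K b 0 + brk K b 0"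
    using assms unfolding poisson_field_def by blast+
  thus "brk K 0 b = 0" "brk K b 0 = 0" by (metis add_0 add_cancel_right_right)+
qed

lemma scal_nonzero:
  assumes "poisson_field K" "c \<noteq> 0"
  shows "scal K c \<noteq> 0"
proof
  assume "scal K c = 0"
  moreover have "scal K (c * inverse c) = scal K c * scal K (inverse c)"
    using assms(1) unfolding poisson_field_def by simp
  moreover have "scal K 1 = 1"
    using assms(1) unfolding poisson_field_def by blast
  ultimately show False using assms(2) by simp
qed

lemma w_valuation_ext_val:
  assumes K: "poisson_field K" and N: "int_valuation K w N"
  shows "w_valuation K w (ext_val N)"
proof -
  have "ext_val N (a * b) = ext_val N a + ext_val N b" for a b
    using N by (simp add: ext_val_def int_valuation_def)
  moreover have "ext_val N (a + b) \<ge> min (ext_val N a) (ext_val N b)" for a b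
    using N by (cases "a = 0"; cases "b = 0") (simp_all add: ext_val_def int_valuation_def)
  moreover have "ext_val N (scal K c) = 0" if "c \<noteq> 0" for c
    using N that scal_nonzero[OF K that]
    by (simp add: ext_val_def int_valuation_def zero_extended_def)
  moreover have "ext_val N (brk K a b) \<ge> ext_val N a + ext_val N b - Fin w" for a b
    using N by (cases "a = 0"; cases "b = 0") (simp_all add: ext_val_def int_valuation_def brk_0[OF K])
  ultimately show ?thesis
    unfolding w_valuation_def by (simp add: ext_val_def)
qed

text \<open>Together with \<open>w_valuation_ext_val\<close> this makes the extended and the
  integer-valued notion interchangeable.\<close>

lemma w_valuationE:
  assumes "w_valuation K w \<nu>"
  obtains N where "int_valuation K w N" "\<nu> = ext_val N"
proof
  \<comment> \<open>The default 0 is taken only at \<open>a = 0\<close>, where no clause of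
    \<open>int_valuation\<close> looks.\<close>
  define N where "N a = (case \<nu> a of Fin n \<Rightarrow> n | _ \<Rightarrow> 0)" for a
  have fin: "\<nu> a = Fin (N a)" if "a \<noteq> 0" for a
    using assms that unfolding w_valuation_def N_def by (auto split: extended.split)
  have fin0: "\<nu> 0 = Pinf"
    using assms unfolding w_valuation_def by blast
  show "\<nu> = ext_val N"
    by (auto simp: ext_val_def fin fin0)
  have "N (a * b) = N a + N b" if "a \<noteq> 0" "b \<noteq> 0" for a b
  proof -
    have "\<nu> (a * b) = \<nu> a + \<nu> b"
      using assms unfolding w_valuation_def by blast
    thus ?thesis using that by (simp add: fin)
  qed
  moreover have "min (N a) (N b) \<le> N (a + b)" if "a \<noteq> 0" "b \<noteq> 0" "a + b \<noteq> 0" for a b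
  proof -
    have "\<nu> (a + b) \<ge> min (\<nu> a) (\<nu> b)"
      using assms unfolding w_valuation_def by blast
    thus ?thesis using that by (simp add: fin)
  qed
  moreover have "N (scal K c) = 0" if "c \<noteq> 0" for c
  proof -
    have "\<nu> (scal K c) = Fin 0"
      using assms that unfolding w_valuation_def zero_extended_def by blast
    thus ?thesis using fin fin0 by (cases "scal K c = 0") auto
  qed
  moreover have "N a + N b - w \<le> N (brk K a b)" if "a \<noteq> 0" "b \<noteq> 0" "brk K a b \<noteq> 0" for a b
  proof -
    have "\<nu> (brk K a b) \<ge> \<nu> a + \<nu> b - Fin w"
      using assms unfolding w_valuation_def by blast
    thus ?thesis using that by (simp add: fin)
  qed
  ultimately show "int_valuation K w N"
    unfolding int_valuation_def by blast
qed

text \<open>A field homomorphism is injective, so \<phi> reflects zero and the infinite value stays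
  confined to zero; the other conditions transfer verbatim.\<close>

lemma w_valuation_pullback:
  assumes "poisson_hom K L \<phi>" and "w_valuation L w \<nu>"
  shows "w_valuation K w (\<nu> \<circ> \<phi>)"
proof -
  have add: "\<phi> (a + b) = \<phi> a + \<phi> b" and mult: "\<phi> (a * b) = \<phi> a * \<phi> b" for a b
    using assms(1) unfolding poisson_hom_def by blast+
  have 0: "\<phi> 0 = 0" using add[of 0 0] by (metis add_0 add_cancel_right_right)
  have "\<phi> a \<noteq> 0" if "a \<noteq> 0" for a
    using mult[of a "inverse a"] that assms(1) unfolding poisson_hom_def by auto
  hence "\<phi> a = 0 \<longleftrightarrow> a = 0" for a using 0 by blast
  thus ?thesis
    using assms unfolding w_valuation_def poisson_hom_def by simp
qed

section \<open>Extending a valuation to the fraction field\<close>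

text \<open>Treats zero as having infinite value, so that bounds can be added and multiplied without
  case distinctions.\<close>

definition val_ge :: "('a::zero \<Rightarrow> int) \<Rightarrow> 'a \<Rightarrow> int \<Rightarrow> bool" where
  "val_ge N q n \<longleftrightarrow> q = 0 \<or> n \<le> N q"

text \<open>Independence of the representation is \<open>fract_val_Fract\<close>. Zero has no
  representation of this kind, so its value is unspecified.\<close>

definition fract_val :: "('a::idom \<Rightarrow> int) \<Rightarrow> 'a fract \<Rightarrow> int" where
  "fract_val v q = (THE n. \<exists>a b. a \<noteq> 0 \<and> b \<noteq> 0 \<and> q = Fract a b \<and> n = v a - v b)"

text \<open>Values may be negative, so that orders of vanishing, negative degrees and their
  extensions to the fraction field are all instances.\<close>

locale ring_valuation =
  fixes v :: "'a::idom \<Rightarrow> int"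
  assumes val_mult: "a \<noteq> 0 \<Longrightarrow> b \<noteq> 0 \<Longrightarrow> v (a * b) = v a + v b"
    and val_add: "a \<noteq> 0 \<Longrightarrow> b \<noteq> 0 \<Longrightarrow> a + b \<noteq> 0 \<Longrightarrow> min (v a) (v b) \<le> v (a + b)"
begin

lemma val_1: "v 1 = 0"
  using val_mult[of 1 1] by simp

lemma val_uminus: "v (- a) = v a"
proof (cases "a = 0")
  case False
  have "v (-1) = 0" using val_mult[of "-1" "-1"] val_1 by simp
  thus ?thesis using val_mult[of "-1" a] False by simp
qed simp

lemma val_ge_add: "val_ge v a n \<Longrightarrow> val_ge v b n \<Longrightarrow> val_ge v (a + b) n"
  unfolding val_ge_def using val_add[of a b] by (cases "a = 0"; cases "b = 0"; cases "a + b = 0") auto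

lemma val_ge_uminus: "val_ge v a n \<Longrightarrow> val_ge v (- a) n"
  unfolding val_ge_def by (simp add: val_uminus)

lemma val_ge_diff: "val_ge v a n \<Longrightarrow> val_ge v b n \<Longrightarrow> val_ge v (a - b) n"
  using val_ge_add[of a n "- b"] val_ge_uminus[of b n] by simp

lemma val_ge_mult: "val_ge v a m \<Longrightarrow> val_ge v b n \<Longrightarrow> val_ge v (a * b) (m + n)"
  unfolding val_ge_def using val_mult[of a b] by (cases "a = 0"; cases "b = 0") auto

lemma val_ge_self: "val_ge v a (v a)"
  by (simp add: val_ge_def)

lemma fract_val_Fract:
  assumes "a \<noteq> 0" "b \<noteq> 0"
  shows "fract_val v (Fract a b) = v a - v b"
  unfolding fract_val_def
proof (rule the_equality)
  fix n assume "\<exists>c d. c \<noteq> 0 \<and> d \<noteq> 0 \<and> Fract a b = Fract c d \<and> n = v c - v d"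
  then obtain c d where cd: "c \<noteq> 0" "d \<noteq> 0" "Fract a b = Fract c d" "n = v c - v d" by blast
  hence "a * d = c * b" using assms by (simp add: eq_fract)
  hence "v a + v d = v c + v b" using val_mult[of a d] val_mult[of c b] assms cd by simp
  thus "n = v a - v b" using cd by simp
qed (use assms in blast)

lemma fract_val_to_fract: "a \<noteq> 0 \<Longrightarrow> fract_val v (to_fract a) = v a"
  by (simp add: to_fract_def fract_val_Fract val_1)

lemma val_ge_to_fract: "val_ge (fract_val v) (to_fract a) n \<longleftrightarrow> val_ge v a n"
  by (cases "a = 0") (simp_all add: val_ge_def fract_val_to_fract)

lemma ring_valuation_fract_val: "ring_valuation (fract_val v)"
proof
  fix x y :: "'a fract"
  assume x: "x \<noteq> 0" and y: "y \<noteq> 0"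
  obtain a b where ab: "x = Fract a b" "b \<noteq> 0" "a \<noteq> 0" using x by (cases x rule: Fract_cases_nonzero) auto
  obtain c d where cd: "y = Fract c d" "d \<noteq> 0" "c \<noteq> 0" using y by (cases y rule: Fract_cases_nonzero) auto
  show "fract_val v (x * y) = fract_val v x + fract_val v y"
    using ab cd by (simp add: fract_val_Fract val_mult)
  assume "x + y \<noteq> 0"
  hence nz: "a * d + c * b \<noteq> 0"
    using ab cd by (auto simp: fract_collapse)
  have "min (v (a * d)) (v (c * b)) \<le> v (a * d + c * b)"
    using ab cd nz by (intro val_add) auto
  thus "min (fract_val v x) (fract_val v y) \<le> fract_val v (x + y)"
    using ab cd nz by (simp add: fract_val_Fract val_mult)
qed

end

text \<open>For \<open>q = u/s\<close>, the Leibniz rule for \<open>q * s = u\<close> isolates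
  \<open>\<delta> q * s\<close> as a difference of two terms, each of value at least
  \<open>v(q) + v(s) + c\<close>; then \<open>v(s)\<close> cancels.\<close>

lemma (in ring_valuation) fract_val_derivation:
  fixes \<delta> :: "'a fract \<Rightarrow> 'a fract"
  assumes leibniz: "\<And>a b. \<delta> (a * b) = \<delta> a * b + a * \<delta> b"
    and bound: "\<And>u. u \<noteq> 0 \<Longrightarrow> val_ge (fract_val v) (\<delta> (to_fract u)) (v u + c)"
    and q: "q \<noteq> 0"
  shows "val_ge (fract_val v) (\<delta> q) (fract_val v q + c)"
proof -
  interpret F: ring_valuation "fract_val v" by (rule ring_valuation_fract_val)
  obtain u s where us: "q = Fract u s" "s \<noteq> 0" "u \<noteq> 0" using q by (cases q rule: Fract_cases_nonzero) auto
  define U S where "U = to_fract u" and "S = to_fract s"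
  have S: "S \<noteq> 0" using us by (simp add: S_def)
  have "U = q * S" using us by (simp add: U_def S_def Fract_conv_to_fract)
  hence "\<delta> U = \<delta> q * S + q * \<delta> S" by (simp add: leibniz)
  hence e: "\<delta> q * S = \<delta> U - q * \<delta> S" by simp
  have vU: "v u = fract_val v q + v s"
    using us by (simp add: fract_val_Fract)
  have "val_ge (fract_val v) (\<delta> U) (fract_val v q + v s + c)"
    using bound[of u] us vU by (simp add: U_def)
  moreover have "val_ge (fract_val v) (q * \<delta> S) (fract_val v q + (v s + c))"
    using bound[of s] us by (intro F.val_ge_mult F.val_ge_self) (simp add: S_def)
  ultimately have "val_ge (fract_val v) (\<delta> q * S) (fract_val v q + v s + c)"
    unfolding e by (intro F.val_ge_diff) (simp_all add: add.assoc)
  moreover have "fract_val v S = v s" using us by (simp add: S_def fract_val_to_fract)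
  ultimately show ?thesis
    using S F.val_mult[of "\<delta> q" S] by (cases "\<delta> q = 0") (auto simp: val_ge_def)
qed

section \<open>Poisson valuations induced from the polynomial ring\<close>

lemma KP_leibniz:
  "brk (KP f) (a * b) c = brk (KP f) a c * b + a * brk (KP f) b c"
  "brk (KP f) c (a * b) = brk (KP f) c a * b + a * brk (KP f) c b"
  by (simp_all add: brk_KP dx_mult dy_mult algebra_simps)

text \<open>The bracket is a derivation in each argument, so a bound on polynomials passes to
  rational functions one argument at a time.\<close>

lemma int_valuation_KP:
  fixes v :: "'k::field poly poly \<Rightarrow> int"
  assumes v: "ring_valuation v" and const: "\<And>c. c \<noteq> 0 \<Longrightarrow> v [:[:c:]:] = 0"
    and bound: "\<And>a b. a \<noteq> 0 \<Longrightarrow> b \<noteq> 0 \<Longrightarrow>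
      val_ge (fract_val v) (brk (KP f) (to_fract a) (to_fract b)) (v a + v b - w)"
  shows "int_valuation (KP f) w (fract_val v)"
proof -
  interpret ring_valuation v by (rule v)
  interpret F: ring_valuation "fract_val v" by (rule ring_valuation_fract_val)
  \<comment> \<open>The first argument becomes rational while the second stays a polynomial; the
    constant shift is \<open>v b - w\<close>.\<close>
  have 1: "val_ge (fract_val v) (brk (KP f) a (to_fract b)) (fract_val v a + (v b - w))"
    if "a \<noteq> 0" "b \<noteq> 0" for a b
    using bound that by (intro fract_val_derivation KP_leibniz) (auto simp: algebra_simps)
  have 2: "val_ge (fract_val v) (brk (KP f) a b) (fract_val v b + (fract_val v a - w))"
    if "a \<noteq> 0" "b \<noteq> 0" for a b
    using 1 that by (intro fract_val_derivation KP_leibniz) (auto simp: algebra_simps)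
  show ?thesis
    unfolding int_valuation_def
    using 2 F.val_mult F.val_add const
    by (auto simp: val_ge_def scal_KP rconst_def fract_val_to_fract algebra_simps)
qed

section \<open>Divisorial valuations\<close>

text \<open>Additive on products of nonzero polynomials and zero only on constants, hence a measure
  for factorization arguments.\<close>

definition poly_size :: "'k::field poly poly \<Rightarrow> nat" where
  "poly_size u = Polynomial.degree u + Polynomial.degree (lead_coeff u)"

lemma poly_size_mult: "u \<noteq> 0 \<Longrightarrow> v \<noteq> 0 \<Longrightarrow> poly_size (u * v) = poly_size u + poly_size v"
  using lead_coeff_mult[of u v] by (simp add: poly_size_def degree_mult_eq)

lemma poly_size_eq_0: "u \<noteq> 0 \<Longrightarrow> poly_size u = 0 \<Longrightarrow> \<exists>c. c \<noteq> 0 \<and> u = [:[:c:]:]"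
proof -
  assume u: "u \<noteq> 0" "poly_size u = 0"
  then obtain p where p: "u = [:p:]" by (auto simp: poly_size_def elim: degree_eq_zeroE)
  hence "Polynomial.degree p = 0" using u by (simp add: poly_size_def)
  thus ?thesis using p u by (auto elim: degree_eq_zeroE)
qed

lemma is_unit_const: "c \<noteq> 0 \<Longrightarrow> [:[:c:]:] dvd (1 :: 'k::field poly poly)"
  by (rule dvdI[of _ _ "[:[:inverse c:]:]"]) (simp flip: one_pCons)

text \<open>A nonconstant divisor of least size is irreducible, since a proper factor would be a
  smaller nonconstant divisor. In the factorial ring \<open>k[x,y]\<close> irreducible elements are
  prime.\<close>

lemma exists_prime_divisor:
  fixes u :: "'k::field poly poly"
  assumes "u \<noteq> 0" "poly_size u > 0"
  shows "\<exists>h. prime_elem h \<and> poly_size h > 0 \<and> h dvd u"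
proof -
  define P where "P h \<longleftrightarrow> h dvd u \<and> poly_size h > 0" for h
  have "P u" using assms by (simp add: P_def)
  then obtain h where h: "P h" and min: "\<And>g. P g \<Longrightarrow> poly_size h \<le> poly_size g"
    using ex_has_least_nat[of P u poly_size] by blast
  have h0: "h \<noteq> 0" using h assms by (auto simp: P_def)
  have "irreducible h"
  proof (rule irreducibleI)
    show "\<not> h dvd 1"
    proof
      assume "h dvd 1"
      then obtain g where "h * g = 1" by (metis dvdE)
      hence "poly_size h + poly_size g = poly_size (1 :: 'k poly poly)"
        using poly_size_mult[of h g] by (cases "g = 0") (auto simp: h0)
      thus False using h by (simp add: P_def, simp add: poly_size_def)
    qed
    fix a b assume ab: "h = a * b"
    have nz: "a \<noteq> 0" "b \<noteq> 0" using ab h0 by auto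
    have "a dvd u" "b dvd u" using h ab by (auto simp: P_def intro: dvd_mult_left dvd_mult_right)
    hence "poly_size a = 0 \<or> poly_size b = 0"
      using min[of a] min[of b] poly_size_mult[OF nz] ab by (auto simp: P_def)
    thus "a dvd 1 \<or> b dvd 1"
      using nz poly_size_eq_0[of a] poly_size_eq_0[of b] by (auto intro: is_unit_const)
  qed (fact h0)
  thus ?thesis using h by (auto simp: P_def)
qed

locale prime_poly =
  fixes h :: "'k::field poly poly"
  assumes prime: "prime_elem h" and size_pos: "poly_size h > 0"
begin

lemma h_nonzero: "h \<noteq> 0"
  using prime unfolding prime_elem_def by blast

text \<open>The maximum exists for nonzero \<open>u\<close> by \<open>power_dvd_bound\<close>. Every
  power divides zero, so \<open>ord 0\<close> carries no meaning.\<close>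

definition ord :: "'k poly poly \<Rightarrow> nat" where
  "ord u = (GREATEST n. h ^ n dvd u)"

lemma poly_size_power: "poly_size (h ^ n) = n * poly_size h"
proof (induction n)
  case 0
  show ?case by (simp add: poly_size_def)
next
  case (Suc n)
  have "poly_size (h ^ Suc n) = poly_size h + poly_size (h ^ n)"
    unfolding power_Suc using h_nonzero by (intro poly_size_mult power_not_zero)
  thus ?case using Suc by simp
qed

lemma power_dvd_bound:
  assumes "u \<noteq> 0" "h ^ n dvd u"
  shows "n \<le> poly_size u"
proof -
  obtain g where g: "u = h ^ n * g" using assms by blast
  hence "poly_size u = n * poly_size h + poly_size g"
    using assms poly_size_mult[of "h ^ n" g] h_nonzero by (auto simp: poly_size_power)
  moreover have "n * 1 \<le> n * poly_size h" using size_pos by (intro mult_le_mono2) simp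
  ultimately show ?thesis by linarith
qed

lemma ord_factor:
  assumes "u \<noteq> 0"
  obtains u' where "u = h ^ ord u * u'" "\<not> h dvd u'"
proof -
  have "h ^ ord u dvd u"
    unfolding ord_def by (rule GreatestI_nat[of "\<lambda>n. h ^ n dvd u" 0 "poly_size u"]) (use power_dvd_bound[OF assms] in auto)
  then obtain u' where u': "u = h ^ ord u * u'" by blast
  have "\<not> h dvd u'"
  proof
    assume "h dvd u'"
    hence "h ^ ord u * h dvd h ^ ord u * u'"
      by (intro mult_dvd_mono) auto
    hence "h ^ Suc (ord u) dvd u"
      using u' by (simp only: power_Suc2)
    hence "Suc (ord u) \<le> ord u"
      unfolding ord_def[of u]
      by (rule Greatest_le_nat[of "\<lambda>n. h ^ n dvd u" _ "poly_size u"]) (use power_dvd_bound[OF assms] in auto)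
    thus False by simp
  qed
  thus thesis using that u' by blast
qed

lemma ord_le_iff:
  assumes "u \<noteq> 0"
  shows "h ^ n dvd u \<longleftrightarrow> n \<le> ord u"
proof
  assume "h ^ n dvd u"
  thus "n \<le> ord u"
    unfolding ord_def
    by (rule Greatest_le_nat[of "\<lambda>n. h ^ n dvd u" _ "poly_size u"]) (use power_dvd_bound[OF assms] in auto)
next
  assume n: "n \<le> ord u"
  obtain u' where "u = h ^ ord u * u'" using ord_factor[OF assms] by blast
  hence "h ^ ord u dvd u" by (rule dvdI)
  thus "h ^ n dvd u" using le_imp_power_dvd[OF n] dvd_trans by blast
qed

lemma ord_eqI:
  assumes "u = h ^ n * u'" "\<not> h dvd u'"
  shows "ord u = n"
proof -
  have u: "u \<noteq> 0" using assms h_nonzero by auto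
  have "n \<le> ord u" using assms ord_le_iff[OF u, of n] by simp
  moreover have "\<not> h ^ Suc n dvd u"
    unfolding assms(1) power_Suc2 using assms(2) h_nonzero by (subst dvd_times_left_cancel_iff) auto
  hence "\<not> Suc n \<le> ord u" using ord_le_iff[OF u] by blast
  ultimately show ?thesis by simp
qed

text \<open>Primality of \<open>h\<close> keeps the product of the two cofactors prime to
  \<open>h\<close>, which makes the order additive.\<close>

lemma ring_valuation_ord: "ring_valuation (\<lambda>u. int (ord u))"
proof
  fix a b :: "'k poly poly" assume a: "a \<noteq> 0" and b: "b \<noteq> 0"
  obtain a' where a': "a = h ^ ord a * a'" "\<not> h dvd a'" using ord_factor[OF a] .
  obtain b' where b': "b = h ^ ord b * b'" "\<not> h dvd b'" using ord_factor[OF b] .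
  have "a * b = (h ^ ord a * a') * (h ^ ord b * b')"
    using a'(1) b'(1) by (rule arg_cong2)
  hence "a * b = h ^ (ord a + ord b) * (a' * b')"
    by (simp only: power_add ac_simps)
  moreover have "\<not> h dvd a' * b'"
    using a' b' prime by (simp add: prime_elem_dvd_mult_iff)
  ultimately show "int (ord (a * b)) = int (ord a) + int (ord b)"
    using ord_eqI[of "a * b"] by simp
  assume ab: "a + b \<noteq> 0"
  have "h ^ min (ord a) (ord b) dvd a + b"
    using ord_le_iff[OF a, of "min (ord a) (ord b)"] ord_le_iff[OF b, of "min (ord a) (ord b)"]
    by (intro dvd_add) simp_all
  thus "min (int (ord a)) (int (ord b)) \<le> int (ord (a + b))"
    using ord_le_iff[OF ab, of "min (ord a) (ord b)"] by simp
qed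

lemma val_ge_ord: "val_ge (\<lambda>u. int (ord u)) u (int n) \<longleftrightarrow> h ^ n dvd u"
  using ord_le_iff[of u n] by (cases "u = 0") (auto simp: val_ge_def)

lemma ord_pos_iff: "u \<noteq> 0 \<Longrightarrow> ord u > 0 \<longleftrightarrow> h dvd u"
  using ord_le_iff[of u 1] by auto

end

section \<open>The Jacobian bracket of polynomials and the order along a prime\<close>

definition poly_brk :: "'k::field poly poly \<Rightarrow> 'k poly poly \<Rightarrow> 'k poly poly" where
  "poly_brk u v = map_poly pderiv u * pderiv v - pderiv u * map_poly pderiv v"

lemma brk_KP_to_fract:
  "brk (KP (to_fract g)) (to_fract u) (to_fract v) = to_fract (poly_brk u v * g)"
  by (simp add: brk_KP dx_to_fract dy_to_fract poly_brk_def)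

lemma poly_brk_mult:
  "poly_brk (a * b) c = poly_brk a c * b + a * poly_brk b c"
  "poly_brk c (a * b) = poly_brk c a * b + a * poly_brk c b"
  by (simp_all add: poly_brk_def map_pderiv_prod_rule pderiv_prod_rule algebra_simps)

lemma poly_brk_self: "poly_brk a a = 0"
  by (simp add: poly_brk_def algebra_simps)

lemma poly_brk_1: "poly_brk 1 a = 0" "poly_brk a 1 = 0"
proof -
  have "map_poly pderiv (1 :: 'a poly poly) = 0"
    by (rule poly_eqI) (simp add: coeff_map_poly)
  thus "poly_brk 1 a = 0" "poly_brk a 1 = 0"
    by (simp_all add: poly_brk_def)
qed

text \<open>Differentiating a power costs one factor. For \<open>n = 0\<close> the truncated
  exponent is 0 and the claim is trivial.\<close>

lemma poly_brk_power_dvd: "h ^ (n - 1) dvd poly_brk (h ^ n) c"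
proof (induction n)
  case (Suc n)
  have "h ^ n dvd h * poly_brk (h ^ n) c"
    using Suc by (cases n) (auto simp: mult_dvd_mono)
  thus ?case by (simp add: poly_brk_mult dvd_add)
qed simp

lemma poly_brk_antisym: "poly_brk a b = - poly_brk b a"
  by (simp add: poly_brk_def algebra_simps)

lemma poly_brk_power_power: "poly_brk (h ^ m) (h ^ n) = 0"
proof -
  have 1: "poly_brk h (h ^ n) = 0" for n
    by (induction n) (simp_all add: poly_brk_mult poly_brk_self poly_brk_1)
  show ?thesis
    by (induction m) (simp_all add: poly_brk_mult 1 poly_brk_1)
qed

text \<open>Only one power of \<open>h\<close> is lost because the two powers of \<open>h\<close> Poisson commute.\<close>

lemma power_dvd_poly_brk:
  assumes "h ^ m dvd a" "h ^ n dvd b"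
  shows "h ^ (m + n - 1) dvd poly_brk a b"
proof -
  obtain a' b' where ab: "a = h ^ m * a'" "b = h ^ n * b'" using assms by (auto elim!: dvdE)
  \<comment> \<open>Four Leibniz terms arise; the one that brackets both powers of \<open>h\<close>
    vanishes by \<open>poly_brk_power_power\<close>.\<close>
  have e: "poly_brk a b = poly_brk (h ^ m) b' * a' * h ^ n
     - poly_brk (h ^ n) a' * b' * h ^ m + h ^ m * h ^ n * poly_brk a' b'"
    unfolding ab poly_brk_mult poly_brk_power_power
    by (simp add: poly_brk_antisym[of a' "h ^ n"] algebra_simps)
  \<comment> \<open>The split on \<open>m\<close> is forced by truncated subtraction:
    \<open>(m - 1) + n\<close> equals \<open>m + n - 1\<close> only for positive \<open>m\<close>,
    and for \<open>m = 0\<close> the bracket is zero.\<close>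
  have "h ^ (m + n - 1) dvd poly_brk (h ^ m) b' * h ^ n" for m n b'
  proof (cases m)
    case 0
    thus ?thesis by (simp add: poly_brk_1)
  next
    case (Suc k)
    hence "h ^ (m - 1) * h ^ n dvd poly_brk (h ^ m) b' * h ^ n"
      by (intro mult_dvd_mono poly_brk_power_dvd) simp
    thus ?thesis using Suc by (simp flip: power_add)
  qed
  hence d: "h ^ (m + n - 1) dvd poly_brk (h ^ m) b' * h ^ n * a'"
    "h ^ (m + n - 1) dvd poly_brk (h ^ n) a' * h ^ m * b'"
    by (metis dvd_mult2 add.commute)+
  have "h ^ (m + n - 1) dvd h ^ (m + n) * poly_brk a' b'"
    by (intro dvd_mult2 le_imp_power_dvd) simp
  from dvd_add[OF dvd_diff[OF d] this] show ?thesis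
    unfolding e by (simp only: power_add mult.assoc mult.commute[of a'] mult.commute[of b'])
qed

text \<open>The weight 1 is the single power of \<open>h\<close> lost in
  \<open>power_dvd_poly_brk\<close>; the polynomial factor \<open>g\<close> cannot lower the
  order.\<close>

lemma (in prime_poly) int_valuation_ord:
  "int_valuation (KP (to_fract g)) 1 (fract_val (\<lambda>u. int (ord u)))"
proof (rule int_valuation_KP[OF ring_valuation_ord])
  fix c :: 'k assume "c \<noteq> 0"
  hence "\<not> h dvd [:[:c:]:]"
    using is_unit_const prime by (meson dvd_trans prime_elem_not_unit)
  thus "int (ord [:[:c:]:]) = 0" using ord_pos_iff[of "[:[:c:]:]"] \<open>c \<noteq> 0\<close> by auto
next
  interpret ring_valuation "\<lambda>u. int (ord u)" by (rule ring_valuation_ord)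
  fix a b :: "'k poly poly" assume "a \<noteq> 0" "b \<noteq> 0"
  hence "h ^ (ord a + ord b - 1) dvd poly_brk a b * g"
    using ord_le_iff by (intro dvd_mult2 power_dvd_poly_brk) auto
  hence "val_ge (\<lambda>u. int (ord u)) (poly_brk a b * g) (int (ord a + ord b - 1))"
    by (simp only: val_ge_ord)
  \<comment> \<open>Truncation of \<open>ord a + ord b - 1\<close> at zero only strengthens the
    bound passed on here.\<close>
  thus "val_ge (fract_val (\<lambda>u. int (ord u))) (brk (KP (to_fract g)) (to_fract a) (to_fract b))
         (int (ord a) + int (ord b) - 1)"
    unfolding brk_KP_to_fract val_ge_to_fract by (auto simp: val_ge_def)
qed

section \<open>Elements integral for all nontrivial 1-valuations\<close>

lemma Gamma0_bound:
  assumes K: "poisson_field K" and N: "int_valuation K n N" and a: "a \<in> Gamma0 n K" "a \<noteq> 0"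
  shows "0 \<le> N a"
proof (rule ccontr)
  \<comment> \<open>A negative value already witnesses nontriviality, so membership in
    \<open>Gamma0\<close> applies to \<open>N\<close>.\<close>
  assume neg: "\<not> 0 \<le> N a"
  hence "\<not> trivial_valuation (ext_val N)"
    using a by (auto simp: trivial_valuation_def ext_val_def zero_extended_def)
  hence "ext_val N a \<ge> 0"
    using a w_valuation_ext_val[OF K N] by (auto simp: Gamma0_def)
  thus False using a neg by (simp add: ext_val_def zero_extended_def)
qed

text \<open>Choose a fraction with denominator of least size. A prime divisor of a nonconstant
  denominator cannot divide the numerator, so the order along it would be negative.\<close>

lemma Gamma0_subset_polynomials:
  fixes g :: "'k::field poly poly"
  shows "Gamma0 1 (KP (to_fract g)) \<subseteq> range to_fract"
proof
  fix q assume q: "q \<in> Gamma0 1 (KP (to_fract g))"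
  define P where "P n \<longleftrightarrow> (\<exists>a b. q = Fract a b \<and> b \<noteq> 0 \<and> poly_size b = n)" for n
  have "\<exists>n. P n" using Fract_cases[of q] unfolding P_def by blast
  then obtain n where n: "P n" and min: "\<And>m. P m \<Longrightarrow> n \<le> m"
    using ex_has_least_nat[of P _ id] by auto
  then obtain a b where ab: "q = Fract a b" "b \<noteq> 0" "poly_size b = n" unfolding P_def by blast
  show "q \<in> range to_fract"
  proof (cases "n = 0 \<or> a = 0")
    case True
    thus ?thesis
    proof
      assume "n = 0"
      then obtain c where c: "c \<noteq> 0" "b = [:[:c:]:]" using poly_size_eq_0 ab by blast
      have "q = to_fract (a * [:[:inverse c:]:])"
        using ab c by (simp add: to_fract_def eq_fract smult_smult flip: one_pCons)
      thus ?thesis by blast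
    next
      assume "a = 0"
      hence "q = to_fract 0" using ab by (simp add: fract_collapse)
      thus ?thesis by blast
    qed
  next
    case False
    then obtain h where h: "prime_elem h" "poly_size h > 0" "h dvd b"
      using exists_prime_divisor[of b] ab by auto
    interpret prime_poly h using h by unfold_locales
    interpret ring_valuation "\<lambda>u. int (ord u)" by (rule ring_valuation_ord)
    have q0: "q \<noteq> 0" using ab False by (simp add: Zero_fract_def eq_fract)
    have "\<not> h dvd a"
    proof
      assume "h dvd a"
      then obtain a' b' where e: "a = h * a'" "b = h * b'" using h by (auto elim!: dvdE)
      hence "q = Fract a' b'" "b' \<noteq> 0" using ab mult_fract_cancel by auto
      hence "n \<le> poly_size b'" using min unfolding P_def by blast
      thus False using ab e h poly_size_mult[of h b'] by auto
    qed
    hence "fract_val (\<lambda>u. int (ord u)) q < 0"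
      using ab h False ord_pos_iff[of a] ord_pos_iff[of b] by (simp add: fract_val_Fract)
    thus ?thesis using Gamma0_bound[OF poisson_field_KP int_valuation_ord q q0] by simp
  qed
qed

section \<open>Degree valuations\<close>

lemma ring_valuation_degree: "ring_valuation (\<lambda>u :: 'a::idom poly. - int (Polynomial.degree u))"
proof
  fix a b :: "'a poly" assume "a \<noteq> 0" "b \<noteq> 0"
  thus "- int (Polynomial.degree (a * b)) = - int (Polynomial.degree a) + - int (Polynomial.degree b)"
    by (simp add: degree_mult_eq)
  show "min (- int (Polynomial.degree a)) (- int (Polynomial.degree b)) \<le> - int (Polynomial.degree (a + b))"
    using degree_add_le_max[of a b] by linarith
qed

text \<open>In \<open>y\<close>-degree the Jacobian gains nothing from the
  \<open>x\<close>-derivative and drops by at least 1 through the \<open>y\<close>-derivative, while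
  \<open>g\<close> adds at most 2: a net loss of value of at most 1.\<close>

lemma int_valuation_degree:
  fixes g :: "'k::field_char_0 poly poly"
  assumes g: "Polynomial.degree g \<le> 2"
  shows "int_valuation (KP (to_fract g)) 1 (fract_val (\<lambda>u. - int (Polynomial.degree u)))"
proof (rule int_valuation_KP[OF ring_valuation_degree])
  interpret ring_valuation "\<lambda>u :: 'k poly poly. - int (Polynomial.degree u)"
    by (rule ring_valuation_degree)
  fix a b :: "'k poly poly"
  let ?v = "\<lambda>u :: 'k poly poly. - int (Polynomial.degree u)"
  have dy: "val_ge ?v (pderiv u) (?v u + 1)" for u
    using degree_pderiv[of u] pderiv_eq_0_iff[of u] by (auto simp: val_ge_def)
  have dx: "val_ge ?v (map_poly pderiv u) (?v u)" for u
    using degree_map_poly_le[of pderiv u] by (simp add: val_ge_def)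
  have "val_ge ?v (map_poly pderiv a * pderiv b) (?v a + ?v b + 1)"
    using val_ge_mult[OF dx[of a] dy[of b]] by (simp add: algebra_simps)
  moreover have "val_ge ?v (pderiv a * map_poly pderiv b) (?v a + ?v b + 1)"
    using val_ge_mult[OF dy[of a] dx[of b]] by (simp add: algebra_simps)
  ultimately have "val_ge ?v (poly_brk a b) (?v a + ?v b + 1)"
    unfolding poly_brk_def by (rule val_ge_diff)
  hence "val_ge ?v (poly_brk a b * g) (?v a + ?v b + 1 + ?v g)"
    by (rule val_ge_mult[OF _ val_ge_self])
  thus "val_ge (fract_val ?v) (brk (KP (to_fract g)) (to_fract a) (to_fract b)) (?v a + ?v b - 1)"
    unfolding brk_KP_to_fract val_ge_to_fract using g by (auto simp: val_ge_def)
qed simp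

lemma Gamma0_subset_xpolynomials:
  fixes g :: "'k::field_char_0 poly poly"
  assumes g: "Polynomial.degree g \<le> 2"
  shows "Gamma0 1 (KP (to_fract g)) \<subseteq> range of_xpoly"
proof
  interpret ring_valuation "\<lambda>u :: 'k poly poly. - int (Polynomial.degree u)"
    by (rule ring_valuation_degree)
  fix q assume q: "q \<in> Gamma0 1 (KP (to_fract g))"
  then obtain u where u: "q = to_fract u" using Gamma0_subset_polynomials by blast
  have "Polynomial.degree u = 0"
  proof (cases "u = 0")
    case False
    thus ?thesis
      using Gamma0_bound[OF poisson_field_KP int_valuation_degree[OF g] q] u
      by (simp add: fract_val_to_fract)
  qed simp
  then obtain p where "u = [:p:]" by (auto elim: degree_eq_zeroE)
  thus "q \<in> range of_xpoly" using u by (simp add: of_xpoly_def)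
qed

section \<open>Total degree as a valuation\<close>

lemma total_degree_le_iff:
  "total_degree u \<le> n \<longleftrightarrow> (\<forall>i j. Polynomial.coeff (Polynomial.coeff u j) i \<noteq> 0 \<longrightarrow> i + j \<le> n)"
  unfolding total_degree_def
  by (subst Max_le_iff) (auto intro: finite_total_degree[unfolded setcompr_eq_image])

lemma le_total_degree: "Polynomial.coeff (Polynomial.coeff u j) i \<noteq> 0 \<Longrightarrow> i + j \<le> total_degree u"
  using total_degree_le_iff[of u "total_degree u"] by blast

lemma total_degree_attained:
  assumes "u \<noteq> 0"
  shows "\<exists>i j. Polynomial.coeff (Polynomial.coeff u j) i \<noteq> 0 \<and> i + j = total_degree u"
proof (rule ccontr)
  assume none: "\<not> ?thesis"
  have less: "i + j < total_degree u" if "Polynomial.coeff (Polynomial.coeff u j) i \<noteq> 0" for i j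
    using none that le_total_degree by (metis le_neq_implies_less)
  hence "total_degree u \<le> total_degree u - 1"
    unfolding total_degree_le_iff by fastforce
  moreover obtain i j where "Polynomial.coeff (Polynomial.coeff u j) i \<noteq> 0"
    using assms by (metis leading_coeff_neq_0)
  ultimately show False using less[of j i] by linarith
qed

text \<open>
  The polynomial \<open>u(xt, yt)\<close> in the additional outermost variable \<open>t\<close>; its degree in \<open>t\<close> is the
  total degree of \<open>u\<close>.
\<close>

definition scale_x :: "'k::field poly \<Rightarrow> 'k poly poly poly" where
  "scale_x p = poly (map_poly (\<lambda>c. [:[:[:c:]:]:]) p) [:0, [:[:0, 1:]:]:]"

definition scale :: "'k::field poly poly \<Rightarrow> 'k poly poly poly" where
  "scale u = poly (map_poly scale_x u) [:0, [:0, 1:]:]"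

text \<open>Changing coefficients and then evaluating respects sums and products. This serves the
  scaling map and, later, roots in the algebraic closure.\<close>

lemma poly_map_poly_hom:
  fixes h :: "'a::idom \<Rightarrow> 'b::idom"
  assumes 0: "h 0 = 0" and add: "\<And>a b. h (a + b) = h a + h b" and mult: "\<And>a b. h (a * b) = h a * h b"
  shows "poly (map_poly h (p + q)) z = poly (map_poly h p) z + poly (map_poly h q) z"
    and "poly (map_poly h (p * q)) z = poly (map_poly h p) z * poly (map_poly h q) z"
proof -
  have map_add: "map_poly h (p + q) = map_poly h p + map_poly h q" for p q
    by (rule poly_eqI) (simp add: coeff_map_poly 0 add)
  have map_smult: "map_poly h (Polynomial.smult c p) = Polynomial.smult (h c) (map_poly h p)" for c p
    by (rule poly_eqI) (simp add: coeff_map_poly 0 mult)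
  have map_pCons: "map_poly h (pCons c p) = pCons (h c) (map_poly h p)" for c p
    by (rule Polynomial.map_poly_pCons) (rule 0)
  show "poly (map_poly h (p + q)) z = poly (map_poly h p) z + poly (map_poly h q) z"
    by (simp add: map_add)
  show "poly (map_poly h (p * q)) z = poly (map_poly h p) z * poly (map_poly h q) z"
    by (induction p) (simp_all add: map_add map_smult map_pCons 0 algebra_simps)
qed

lemma scale_x_pCons: "scale_x (pCons a p) = [:[:[:a:]:]:] + [:0, [:[:0, 1:]:]:] * scale_x p"
  by (simp add: scale_x_def Polynomial.map_poly_pCons)

lemma scale_x_0: "scale_x 0 = 0"
  by (simp add: scale_x_def)

lemma scale_pCons: "scale (pCons p u) = scale_x p + [:0, [:0, 1:]:] * scale u"
  by (simp add: scale_def Polynomial.map_poly_pCons scale_x_0)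

lemma scale_mult: "scale (u * v) = scale u * scale v"
proof -
  have "scale_x (p + q) = scale_x p + scale_x q" "scale_x (p * q) = scale_x p * scale_x q" for p q :: "'a poly"
    unfolding scale_x_def by (rule poly_map_poly_hom; simp)+
  thus ?thesis
    unfolding scale_def by (intro poly_map_poly_hom scale_x_0)
qed

lemma coeff_scale_x: "Polynomial.coeff (scale_x p) n = [:Polynomial.monom (Polynomial.coeff p n) n:]"
proof (induction p arbitrary: n)
  case (pCons a p)
  show ?case
    by (cases n) (simp_all add: scale_x_pCons pCons.IH monom_0 monom_Suc)
qed (simp add: scale_x_0)

text \<open>The coefficient of \<open>t^n\<close> is the homogeneous component of degree
  \<open>n\<close>, so scaling separates the grading.\<close>

lemma coeff_scale:
  "Polynomial.coeff (Polynomial.coeff (Polynomial.coeff (scale u) n) j) i =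
     (if i + j = n then Polynomial.coeff (Polynomial.coeff u j) i else 0)"
proof (induction u arbitrary: n j)
  case 0
  thus ?case by (simp add: scale_def)
next
  case (pCons p u)
  show ?case
    by (cases n; cases j) (auto simp: scale_pCons coeff_scale_x pCons.IH)
qed

lemma degree_scale: "Polynomial.degree (scale u) = total_degree u"
proof (rule antisym)
  show "Polynomial.degree (scale u) \<le> total_degree u"
  proof (intro degree_le allI impI poly_eqI)
    fix n j i assume "total_degree u < n"
    thus "Polynomial.coeff (Polynomial.coeff (Polynomial.coeff (scale u) n) j) i =
        Polynomial.coeff (Polynomial.coeff 0 j) i"
      using le_total_degree[of u j i]
      by (cases "Polynomial.coeff (Polynomial.coeff u j) i = 0") (auto simp: coeff_scale)
  qed
  show "total_degree u \<le> Polynomial.degree (scale u)"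
  proof (cases "u = 0")
    case False
    then obtain i j where ij: "Polynomial.coeff (Polynomial.coeff u j) i \<noteq> 0" "i + j = total_degree u"
      using total_degree_attained by blast
    hence "Polynomial.coeff (Polynomial.coeff (Polynomial.coeff (scale u) (total_degree u)) j) i \<noteq> 0"
      by (simp add: coeff_scale)
    thus ?thesis by (intro le_degree) auto
  qed (simp add: total_degree_def)
qed

lemma scale_eq_0_iff: "scale u = 0 \<longleftrightarrow> u = 0"
proof
  assume 0: "scale u = 0"
  show "u = 0"
    by (intro poly_eqI) (use coeff_scale[of u] 0 in \<open>metis coeff_0\<close>)
qed (simp add: scale_def)

text \<open>Scaling is multiplicative, and degrees in \<open>t\<close> add over the integral domain
  \<open>k[x,y]\<close>.\<close>

lemma total_degree_mult: "u \<noteq> 0 \<Longrightarrow> v \<noteq> 0 \<Longrightarrow> total_degree (u * v) = total_degree u + total_degree v"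
  by (simp add: scale_mult scale_eq_0_iff degree_mult_eq flip: degree_scale)

lemma ring_valuation_total_degree: "ring_valuation (\<lambda>u :: 'k::field poly poly. - int (total_degree u))"
proof
  fix a b :: "'k poly poly" assume "a \<noteq> 0" "b \<noteq> 0"
  thus "- int (total_degree (a * b)) = - int (total_degree a) + - int (total_degree b)"
    by (simp add: total_degree_mult)
  have "total_degree (a + b) \<le> max (total_degree a) (total_degree b)"
    unfolding total_degree_le_iff
    using total_degree_le_iff[of a "total_degree a"] total_degree_le_iff[of b "total_degree b"]
    by (simp add: le_max_iff_disj) (metis add_0)
  thus "min (- int (total_degree a)) (- int (total_degree b)) \<le> - int (total_degree (a + b))"
    by linarith
qed

lemma total_degree_const: "total_degree [:[:c:]:] = 0"
  using total_degree_le_iff[of "[:[:c:]:]" 0] by (auto simp: coeff_pCons split: nat.splits)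

lemma total_degree_xpoly: "total_degree [:p:] = Polynomial.degree p"
proof (rule antisym)
  show "total_degree [:p:] \<le> Polynomial.degree p"
    unfolding total_degree_le_iff by (auto simp: coeff_pCons le_degree split: nat.splits)
  show "Polynomial.degree p \<le> total_degree [:p:]"
    using le_total_degree[of "[:p:]" 0 "Polynomial.degree p"] by (cases "p = 0") auto
qed

lemma total_degree_Y: "total_degree [:0, 1:] = 1"
proof (rule antisym)
  show "total_degree [:0, 1 :: 'a poly:] \<le> 1"
    unfolding total_degree_le_iff by (auto simp: coeff_pCons split: nat.splits)
  show "1 \<le> total_degree [:0, 1 :: 'a poly:]"
    using le_total_degree[of "[:0, 1 :: 'a poly:]" 1 0] by simp
qed

lemma total_degree_eq_0:
  assumes "total_degree u = 0"
  shows "\<exists>c. u = [:[:c:]:]"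
proof
  have "Polynomial.coeff (Polynomial.coeff u j) i = 0" if "i + j > 0" for i j
    using total_degree_le_iff[of u 0] assms that by (metis le_zero_eq less_not_refl)
  thus "u = [:[:Polynomial.coeff (Polynomial.coeff u 0) 0:]:]"
    by (intro poly_eqI) (auto simp: coeff_pCons split: nat.splits)
qed

text \<open>Each of the two derivatives lowers the total degree by at least 1 and \<open>g\<close>
  raises it by its own degree, whence the shift by 2 in the weight.\<close>

lemma int_valuation_total_degree:
  fixes g :: "'k::field poly poly"
  shows "int_valuation (KP (to_fract g)) (int (total_degree g) - 2)
           (fract_val (\<lambda>u. - int (total_degree u)))"
proof (rule int_valuation_KP[OF ring_valuation_total_degree])
  interpret ring_valuation "\<lambda>u :: 'k poly poly. - int (total_degree u)"
    by (rule ring_valuation_total_degree)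
  fix a b :: "'k poly poly"
  let ?v = "\<lambda>u :: 'k poly poly. - int (total_degree u)"
  \<comment> \<open>A single monomial of top degree in \<open>u'\<close> converts a shift of
    exponents into a drop of the total degree.\<close>
  have lower: "val_ge ?v u' (?v u + 1)"
    if shift: "\<And>i j. Polynomial.coeff (Polynomial.coeff u' j) i \<noteq> 0 \<Longrightarrow> Suc (i + j) \<le> total_degree u" for u u'
  proof (cases "u' = 0")
    case False
    then obtain i j where "Polynomial.coeff (Polynomial.coeff u' j) i \<noteq> 0" "i + j = total_degree u'"
      using total_degree_attained by blast
    thus ?thesis using shift[of j i] by (simp add: val_ge_def)
  qed (simp add: val_ge_def)
  have dy: "val_ge ?v (pderiv u) (?v u + 1)" for u
  proof (rule lower)
    fix i j assume nz: "Polynomial.coeff (Polynomial.coeff (pderiv u) j) i \<noteq> 0"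
    have "Polynomial.coeff (Polynomial.coeff u (Suc j)) i \<noteq> 0"
    proof
      assume 0: "Polynomial.coeff (Polynomial.coeff u (Suc j)) i = 0"
      have "Polynomial.coeff (of_nat n * p) i = of_nat n * Polynomial.coeff p i" for n and p :: "'k poly"
        by (induction n) (simp_all add: algebra_simps)
      thus False using nz 0 by (simp add: coeff_pderiv del: of_nat_Suc)
    qed
    thus "Suc (i + j) \<le> total_degree u" using le_total_degree[of u "Suc j" i] by simp
  qed
  have dx: "val_ge ?v (map_poly pderiv u) (?v u + 1)" for u
  proof (rule lower)
    fix i j assume nz: "Polynomial.coeff (Polynomial.coeff (map_poly pderiv u) j) i \<noteq> 0"
    hence "Polynomial.coeff (Polynomial.coeff u j) (Suc i) \<noteq> 0"
      by (auto simp: coeff_map_poly coeff_pderiv)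
    thus "Suc (i + j) \<le> total_degree u" using le_total_degree[of u j "Suc i"] by simp
  qed
  have "val_ge ?v (poly_brk a b) (?v a + 1 + (?v b + 1))"
    unfolding poly_brk_def by (intro val_ge_diff val_ge_mult dx dy)
  hence "val_ge ?v (poly_brk a b * g) (?v a + 1 + (?v b + 1) + ?v g)"
    by (rule val_ge_mult[OF _ val_ge_self])
  thus "val_ge (fract_val ?v) (brk (KP (to_fract g)) (to_fract a) (to_fract b))
          (?v a + ?v b - (int (total_degree g) - 2))"
    unfolding brk_KP_to_fract val_ge_to_fract by (simp add: algebra_simps)
qed (simp add: total_degree_const)

section \<open>Valuations and heights of \<open>K{p(x)xy}\<close>\<close>

lemma ring_valuation_int_valuation: "int_valuation K w N \<Longrightarrow> ring_valuation N"
  by unfold_locales (simp_all add: int_valuation_def)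

lemma int_valuation_brk:
  "int_valuation K w N \<Longrightarrow> a \<noteq> 0 \<Longrightarrow> b \<noteq> 0 \<Longrightarrow> brk K a b \<noteq> 0 \<Longrightarrow> N a + N b - w \<le> N (brk K a b)"
  by (simp add: int_valuation_def)

text \<open>Writing \<open>a = (a + b) - b\<close> gives the reverse of the usual inequality. The
  conditional premise lets \<open>b\<close> be zero, as a constant coefficient may be.\<close>

lemma (in ring_valuation) val_add_less:
  assumes "a \<noteq> 0" "b \<noteq> 0 \<Longrightarrow> v a < v b"
  shows "v (a + b) = v a"
proof (cases "b = 0")
  case False
  hence less: "v a < v b" by (rule assms)
  have nz: "a + b \<noteq> 0"
  proof
    assume "a + b = 0"
    hence "b = - a" by (simp add: add_eq_0_iff)
    thus False using less val_uminus[of a] by simp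
  qed
  have "min (v (a + b)) (v (- b)) \<le> v (a + b + - b)"
    using nz False assms by (intro val_add) auto
  moreover have "min (v a) (v b) \<le> v (a + b)"
    using nz False assms by (intro val_add) auto
  ultimately show ?thesis using less by (simp add: val_uminus)
qed simp

lemma of_xpoly_hom:
  "of_xpoly (p + q) = of_xpoly p + of_xpoly q"
  "of_xpoly (p * q) = of_xpoly p * of_xpoly q"
  "of_xpoly 0 = 0"
  by (simp_all add: of_xpoly_def flip: to_fract_add to_fract_mult one_pCons)

lemma of_xpoly_const: "of_xpoly [:c:] = rconst c"
  by (simp add: of_xpoly_def rconst_def)

lemma of_xpoly_X: "of_xpoly [:0, 1:] = ratX"
  by (simp add: of_xpoly_def ratX_def)

lemma of_xpoly_pCons: "of_xpoly (pCons a p) = rconst a + ratX * of_xpoly p"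
proof -
  have "pCons a p = [:a:] + [:0, 1:] * p" by simp
  thus ?thesis by (metis of_xpoly_hom(1,2) of_xpoly_const of_xpoly_X)
qed

lemma of_xpoly_eq_0_iff: "of_xpoly p = 0 \<longleftrightarrow> p = 0"
  by (simp add: of_xpoly_def)

lemma rconst_eq_0_iff: "rconst c = 0 \<longleftrightarrow> c = 0"
  by (simp add: rconst_def)

lemma ratX_nonzero: "ratX \<noteq> 0" and ratY_nonzero: "ratY \<noteq> 0"
  by (simp_all add: ratX_def ratY_def)

lemma ratX_not_const: "ratX \<noteq> rconst c"
  by (simp add: ratX_def rconst_def)

section \<open>Evaluating valuations at the bracket p(x)xy\<close>

definition xy_poly :: "'k::field poly \<Rightarrow> 'k poly poly" where
  "xy_poly p = [:p:] * [:[:0, 1:]:] * [:0, 1:]"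

lemma to_fract_xy_poly: "to_fract (xy_poly p) = of_xpoly p * ratX * ratY"
  unfolding xy_poly_def of_xpoly_def ratX_def ratY_def to_fract_mult ..

lemma degree_xy_poly: "Polynomial.degree (xy_poly p) \<le> 2"
  by (simp add: xy_poly_def)

lemma total_degree_xy_poly:
  assumes "p \<noteq> 0"
  shows "total_degree (xy_poly p) = Polynomial.degree p + 2"
proof -
  have "total_degree (xy_poly p) = total_degree ([:p:] * [:[:0, 1:]:]) + total_degree [:0, 1 :: 'a poly:]"
    unfolding xy_poly_def by (rule total_degree_mult) (use assms in auto)
  also have "total_degree ([:p:] * [:[:0, 1:]:]) = total_degree [:p:] + total_degree [:[:0, 1 :: 'a:]:]"
    by (rule total_degree_mult) (use assms in auto)
  finally show ?thesis
    by (simp only: total_degree_xpoly total_degree_Y) simp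
qed

text \<open>In each Horner step \<open>ratX\<close> times the previous polynomial has negative
  value, below the value 0 of a nonzero constant, so the leading term decides.\<close>

lemma val_of_xpoly:
  assumes N: "int_valuation (KP f) w N" and neg: "N ratX < 0" and p: "p \<noteq> 0"
  shows "N (of_xpoly p) = int (Polynomial.degree p) * N ratX"
  using p
proof (induction p)
  case (pCons a p)
  interpret ring_valuation N by (rule ring_valuation_int_valuation) (rule N)
  have const: "N (rconst a) = 0" if "a \<noteq> 0"
    using N that by (simp add: int_valuation_def scal_KP)
  show ?case
  proof (cases "p = 0")
    case True
    thus ?thesis using pCons const by (simp add: of_xpoly_const)
  next
    case False
    have "N (ratX * of_xpoly p) = N ratX + N (of_xpoly p)"
      using False by (intro val_mult) (auto simp: ratX_nonzero of_xpoly_eq_0_iff)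
    also have "\<dots> = int (Polynomial.degree (pCons a p)) * N ratX"
      using pCons.IH False by (simp add: algebra_simps)
    finally have X: "N (ratX * of_xpoly p) = int (Polynomial.degree (pCons a p)) * N ratX" .
    have "int (Polynomial.degree (pCons a p)) * N ratX < 0"
      using False neg by (intro mult_pos_neg) auto
    hence "N (ratX * of_xpoly p + rconst a) = N (ratX * of_xpoly p)"
      using False X const
      by (intro val_add_less) (auto simp: ratX_nonzero of_xpoly_eq_0_iff rconst_eq_0_iff)
    thus ?thesis using X by (simp add: of_xpoly_pCons add.commute)
  qed
qed simp

lemma val_ge_of_xpoly:
  assumes N: "int_valuation (KP f) w N" and nonneg: "N ratX \<ge> 0"
  shows "val_ge N (of_xpoly p) 0"
proof (induction p)
  case (pCons a p)
  interpret ring_valuation N by (rule ring_valuation_int_valuation) (rule N)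
  have "val_ge N (rconst a) 0"
    using N by (cases "a = 0") (simp_all add: val_ge_def int_valuation_def scal_KP)
  moreover have "val_ge N (ratX * of_xpoly p) (0 + 0)"
    using nonneg pCons.IH by (intro val_ge_mult) (auto simp: val_ge_def)
  ultimately show ?case
    unfolding of_xpoly_pCons by (intro val_ge_add) simp_all
qed (simp add: val_ge_def of_xpoly_hom)

text \<open>In the valuation inequality for \<open>{x, y} = p(x)xy\<close> the values of
  \<open>x\<close> and \<open>y\<close> cancel, leaving \<open>- w \<le> N(p)\<close>; a pole at
  \<open>x\<close> makes \<open>N(p)\<close> equal to \<open>deg p * N(x)\<close>.\<close>

lemma degree_mult_le_weight:
  assumes N: "int_valuation (KP (of_xpoly p * ratX * ratY)) w N" and neg: "N ratX < 0" and p: "p \<noteq> 0"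
  shows "int (Polynomial.degree p) * (- N ratX) \<le> w"
proof -
  interpret ring_valuation N by (rule ring_valuation_int_valuation) (rule N)
  note nz = ratX_nonzero ratY_nonzero
  have p0: "of_xpoly p \<noteq> 0" using p by (simp add: of_xpoly_eq_0_iff)
  have "N ratX + N ratY - w \<le> N (brk (KP (of_xpoly p * ratX * ratY)) ratX ratY)"
    using p0 by (intro int_valuation_brk[OF N] nz) (simp add: brk_KP_X_Y nz)
  also have "\<dots> = N (of_xpoly p) + N ratX + N ratY"
    using p0 by (simp add: nz brk_KP_X_Y val_mult)
  finally show ?thesis
    using val_of_xpoly[OF N neg p] by simp
qed

lemma Gamma0_xy_subset:
  fixes p :: "'k::field_char_0 poly"
  shows "Gamma0 1 (KP (of_xpoly p * ratX * ratY)) \<subseteq> range of_xpoly"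
  using Gamma0_subset_xpolynomials[OF degree_xy_poly] by (simp only: to_fract_xy_poly)

lemma ext_val_nonneg_iff: "ext_val N a \<ge> 0 \<longleftrightarrow> val_ge N a 0"
  by (simp add: ext_val_def val_ge_def zero_extended_def)

text \<open>A 1-valuation with a pole at \<open>x\<close> would give
  \<open>2 \<le> deg p * (- N(x)) \<le> 1\<close>, so \<open>x\<close>, and with it every polynomial
  in \<open>x\<close>, is integral.\<close>

lemma Gamma0_xy:
  fixes p :: "'k::field_char_0 poly"
  assumes p: "p \<noteq> 0" "Polynomial.degree p \<ge> 2"
  shows "Gamma0 1 (KP (of_xpoly p * ratX * ratY)) = range of_xpoly"
proof (intro equalityI Gamma0_xy_subset subsetI)
  fix a :: "'k ratfun" assume "a \<in> range of_xpoly"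
  then obtain q where q: "a = of_xpoly q" by blast
  have "\<nu> a \<ge> 0" if "w_valuation (KP (of_xpoly p * ratX * ratY)) 1 \<nu>" for \<nu>
  proof -
    obtain N where N: "int_valuation (KP (of_xpoly p * ratX * ratY)) 1 N" "\<nu> = ext_val N"
      using w_valuationE[OF \<open>w_valuation _ 1 \<nu>\<close>] .
    have "N ratX \<ge> 0"
    proof (rule ccontr)
      assume "\<not> N ratX \<ge> 0"
      hence neg: "N ratX < 0" by simp
      have "2 * 1 \<le> int (Polynomial.degree p) * (- N ratX)"
        using p neg by (intro mult_mono) auto
      thus False using degree_mult_le_weight[OF N(1) neg p(1)] by simp
    qed
    thus ?thesis
      using val_ge_of_xpoly[OF N(1)] N(2) q by (simp add: ext_val_nonneg_iff)
  qed
  thus "a \<in> Gamma0 1 (KP (of_xpoly p * ratX * ratY))"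
    by (simp add: Gamma0_def)
qed

text \<open>The infimum is the minimum \<open>deg p\<close>, attained by the negative total degree.
  The intersection condition forces every competing valuation to have a pole at
  \<open>x\<close>.\<close>

lemma vht_xy:
  fixes p :: "'k::field_char_0 poly"
  assumes p: "p \<noteq> 0" "Polynomial.degree p \<ge> 2"
  shows "vht 1 (KP (of_xpoly p * ratX * ratY)) = ereal (Polynomial.degree p + 2)"
proof -
  define K where "K = KP (of_xpoly p * ratX * ratY)"
  define S where "S = {w. \<exists>\<nu>. w_valuation K w \<nu> \<and> \<not> classical_valuation K w \<nu> \<and>
                          F0 \<nu> \<inter> Gamma0 1 K = range (scal K)}"
  let ?d = "int (Polynomial.degree p)"
  let ?v = "\<lambda>u :: 'k poly poly. - int (total_degree u)"
  interpret ring_valuation ?v by (rule ring_valuation_total_degree)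
  interpret F: ring_valuation "fract_val ?v" by (rule ring_valuation_fract_val)
  have G: "Gamma0 1 K = range of_xpoly"
    unfolding K_def by (rule Gamma0_xy[OF p])
  have K_xy: "K = KP (to_fract (xy_poly p))"
    by (simp add: K_def to_fract_xy_poly)
  have N: "int_valuation K ?d (fract_val ?v)"
    using int_valuation_total_degree[of "xy_poly p"] p by (simp add: K_xy total_degree_xy_poly)
  have vX: "fract_val ?v ratX = -1" and vY: "fract_val ?v ratY = -1"
    unfolding ratX_def ratY_def using total_degree_Y[where 'a='k]
    by (simp_all add: fract_val_to_fract total_degree_xpoly)
  \<comment> \<open>The pair \<open>x\<close>, \<open>y\<close> gives equality:
    \<open>-(d + 2) = -1 - 1 - d\<close>.\<close>
  have "\<not> classical_valuation K ?d (ext_val (fract_val ?v))"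
  proof
    assume "classical_valuation K ?d (ext_val (fract_val ?v))"
    hence "ext_val (fract_val ?v) (brk K ratX ratY)
        > ext_val (fract_val ?v) ratX + ext_val (fract_val ?v) ratY - Fin ?d"
      using ratX_nonzero ratY_nonzero by (auto simp: classical_valuation_def)
    moreover have "xy_poly p \<noteq> 0" using p by (simp add: xy_poly_def)
    ultimately show False
      using p by (simp add: K_xy brk_KP_X_Y ext_val_def vX vY fract_val_to_fract total_degree_xy_poly
          ratX_nonzero ratY_nonzero)
  qed
  moreover have "F0 (ext_val (fract_val ?v)) \<inter> Gamma0 1 K = range (scal K)"
  proof (intro equalityI subsetI)
    fix a assume "a \<in> F0 (ext_val (fract_val ?v)) \<inter> Gamma0 1 K"
    then obtain q where q: "a = of_xpoly q" "val_ge (fract_val ?v) a 0"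
      by (auto simp: G F0_def ext_val_nonneg_iff)
    hence "val_ge ?v [:q:] 0" by (simp add: of_xpoly_def val_ge_to_fract)
    hence "Polynomial.degree q = 0" by (auto simp: val_ge_def total_degree_xpoly)
    then obtain c where "q = [:c:]" by (auto elim: degree_eq_zeroE)
    thus "a \<in> range (scal K)" using q by (simp add: K_def scal_KP of_xpoly_const)
  next
    fix a assume "a \<in> range (scal K)"
    then obtain c where c: "a = rconst c" by (auto simp: K_def scal_KP)
    have "val_ge (fract_val ?v) a 0"
      unfolding c rconst_def val_ge_to_fract by (simp add: val_ge_def total_degree_const)
    thus "a \<in> F0 (ext_val (fract_val ?v)) \<inter> Gamma0 1 K"
      using c of_xpoly_const[of c] by (auto simp: G F0_def ext_val_nonneg_iff intro: range_eqI[of _ _ "[:c:]"])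
  qed
  moreover have "w_valuation K ?d (ext_val (fract_val ?v))"
    using N by (intro w_valuation_ext_val) (simp_all add: K_def poisson_field_KP)
  ultimately have d: "?d \<in> S" unfolding S_def by blast
  have lower: "?d \<le> w" if w: "w \<in> S" for w
  proof -
    obtain \<nu> where \<nu>: "w_valuation K w \<nu>" "F0 \<nu> \<inter> Gamma0 1 K = range (scal K)"
      using w unfolding S_def by blast
    obtain M where M: "int_valuation K w M" "\<nu> = ext_val M" using w_valuationE[OF \<nu>(1)] .
    \<comment> \<open>\<open>x\<close> is 1-integral but not constant, so the intersection condition
      excludes it from \<open>F0 \<nu>\<close>.\<close>
    have "ratX \<notin> range (scal K)" using ratX_not_const by (auto simp: K_def scal_KP)
    moreover have "ratX \<in> Gamma0 1 K" unfolding G using of_xpoly_X by (metis rangeI)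
    ultimately have "\<not> val_ge M ratX 0" using \<nu>(2) M(2) by (auto simp: F0_def ext_val_nonneg_iff)
    hence neg: "M ratX < 0" by (simp add: val_ge_def)
    have "?d * 1 \<le> ?d * (- M ratX)" using neg by (intro mult_left_mono) auto
    thus ?thesis using degree_mult_le_weight[OF M(1)[unfolded K_def] neg p(1)] by simp
  qed
  have "ereal (of_int ?d) \<le> ereal (of_int w)" if "w \<in> S" for w
    using lower[OF that] by (simp only: ereal_less_eq of_int_le_iff)
  hence "(INF w\<in>S. ereal (of_int w)) = ereal (of_int ?d)"
    using d by (intro antisym INF_lower INF_greatest)
  thus ?thesis
    unfolding vht_def S_def[symmetric] K_def[symmetric] by (simp add: numeral_eq_ereal add.commute)
qed

section \<open>Poisson homomorphisms\<close>

text \<open>Pull valuations back along \<phi>. If the pullback is trivial, its values are 0 or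
  infinite and hence still nonnegative.\<close>

lemma Gamma0_hom:
  assumes "poisson_hom K L \<phi>" and a: "a \<in> Gamma0 n K"
  shows "\<phi> a \<in> Gamma0 n L"
proof -
  have "\<nu> (\<phi> a) \<ge> 0" if \<nu>: "w_valuation L n \<nu>" for \<nu>
  proof (cases "trivial_valuation (\<nu> \<circ> \<phi>)")
    case True
    have "\<nu> (\<phi> 0) = Pinf"
      using w_valuation_pullback[OF assms(1) \<nu>] by (auto simp: w_valuation_def)
    thus ?thesis using True by (cases "a = 0") (auto simp: trivial_valuation_def)
  next
    case False
    thus ?thesis
      using a w_valuation_pullback[OF assms(1) \<nu>] by (fastforce simp: Gamma0_def)
  qed
  thus ?thesis by (simp add: Gamma0_def)
qed

locale poisson_homomorphism =
  fixes f h :: "'k::field_char_0 ratfun" and \<phi>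
  assumes hom: "poisson_hom (KP f) (KP h) \<phi>"
begin

lemma hom_add: "\<phi> (a + b) = \<phi> a + \<phi> b"
  and hom_mult: "\<phi> (a * b) = \<phi> a * \<phi> b"
  and hom_1: "\<phi> 1 = 1"
  and hom_const: "\<phi> (rconst c) = rconst c"
  and hom_brk: "\<phi> (brk (KP f) a b) = brk (KP h) (\<phi> a) (\<phi> b)"
  using hom unfolding poisson_hom_def scal_KP by blast+

lemma hom_0: "\<phi> 0 = 0"
  using hom_const[of 0] by simp

lemma hom_diff: "\<phi> (a - b) = \<phi> a - \<phi> b"
  using hom_add[of "a - b" b] by (simp add: algebra_simps)

lemma hom_eq_0_iff: "\<phi> a = 0 \<longleftrightarrow> a = 0"
proof
  assume "\<phi> a = 0"
  thus "a = 0" using hom_mult[of a "inverse a"] hom_1 by (cases "a = 0") auto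
qed (simp add: hom_0)

lemma hom_inj: "inj \<phi>"
proof (rule injI)
  fix a b assume "\<phi> a = \<phi> b"
  thus "a = b" using hom_eq_0_iff[of "a - b"] hom_diff[of a b] by simp
qed

lemma hom_divide: "\<phi> (a / b) = \<phi> a / \<phi> b"
proof (cases "b = 0")
  case False
  hence "\<phi> (a / b) * \<phi> b = \<phi> a" by (simp flip: hom_mult)
  thus ?thesis using False hom_eq_0_iff[of b] by (simp add: field_simps)
qed (simp add: hom_0)

lemma hom_xpoly:
  assumes "\<phi> ratX = of_xpoly g"
  shows "\<phi> (of_xpoly p) = of_xpoly (pcompose p g)"
proof (induction p)
  case (pCons a p)
  show ?case
    by (simp add: of_xpoly_pCons pcompose_pCons of_xpoly_hom of_xpoly_const hom_add hom_mult hom_const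
        assms pCons.IH)
qed (simp add: of_xpoly_hom hom_0)

text \<open>The range is a subfield containing the constants, and \<open>x\<close> and
  \<open>y\<close> generate the whole field over them.\<close>

lemma surj_if_generators:
  assumes X: "ratX \<in> range \<phi>" and Y: "ratY \<in> range \<phi>"
  shows "surj \<phi>"
proof -
  have add: "a + b \<in> range \<phi>" and mult: "a * b \<in> range \<phi>" and div: "a / b \<in> range \<phi>"
    if "a \<in> range \<phi>" "b \<in> range \<phi>" for a b
    using that by (auto simp flip: hom_add hom_mult hom_divide)
  have const: "rconst c \<in> range \<phi>" for c using hom_const by (metis rangeI)
  have xpoly: "of_xpoly p \<in> range \<phi>" for p
  proof (induction p)
    case 0
    show ?case using const[of 0] by (simp add: of_xpoly_hom)
  next
    case (pCons a p)
    thus ?case unfolding of_xpoly_pCons by (intro add mult const X)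
  qed
  have poly: "to_fract u \<in> range \<phi>" for u
  proof (induction u)
    case 0
    show ?case using const[of 0] by simp
  next
    case (pCons p u)
    have "pCons p u = [:p:] + [:0, 1:] * u" by simp
    hence "to_fract (pCons p u) = of_xpoly p + ratY * to_fract u"
      unfolding of_xpoly_def ratY_def by (metis to_fract_add to_fract_mult)
    thus ?case using pCons add mult xpoly Y by metis
  qed
  show ?thesis
  proof (intro equalityI subsetI UNIV_I)
    fix q :: "'k ratfun"
    show "q \<in> range \<phi>"
      by (cases q) (simp add: Fract_conv_to_fract div poly)
  qed
qed

end

text \<open>Pull the negative total degree of \<open>K{g}\<close> back to a valuation of weight
  \<open>deg g - 2\<close>. The image of \<open>x\<close> is 1-integral, hence a polynomial, and
  nonconstant by injectivity; so \<open>x\<close> has a pole and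
  \<open>deg p \<le> deg g - 2\<close>.\<close>

lemma fht_xy:
  fixes p :: "'k::field_char_0 poly"
  assumes p: "p \<noteq> 0" "Polynomial.degree p \<ge> 2"
  shows "fht (KP (of_xpoly p * ratX * ratY)) = enat (Polynomial.degree p + 2)"
proof -
  define K where "K = KP (of_xpoly p * ratX * ratY)"
  have lower: "enat (Polynomial.degree p + 2) \<le> enat (total_degree g)"
    if iso: "poisson_isomorphic K (KP (to_fract g))" for g
  proof -
    obtain \<phi> where hom: "poisson_hom K (KP (to_fract g)) \<phi>"
      using iso unfolding poisson_isomorphic_def poisson_iso_def by blast
    interpret poisson_homomorphism "of_xpoly p * ratX * ratY" "to_fract g" \<phi>
      by unfold_locales (use hom in \<open>simp add: K_def\<close>)
    let ?v = "\<lambda>u :: 'k poly poly. - int (total_degree u)"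
    interpret ring_valuation ?v by (rule ring_valuation_total_degree)
    have "w_valuation K (int (total_degree g) - 2) (ext_val (fract_val ?v) \<circ> \<phi>)"
      unfolding K_def using w_valuation_pullback[OF hom w_valuation_ext_val[OF poisson_field_KP int_valuation_total_degree]] .
    then obtain M where M: "int_valuation K (int (total_degree g) - 2) M"
        "ext_val (fract_val ?v) \<circ> \<phi> = ext_val M"
      using w_valuationE by blast
    have "ratX \<in> Gamma0 1 K"
      unfolding K_def Gamma0_xy[OF p] using of_xpoly_X by (metis rangeI)
    then obtain u where u: "\<phi> ratX = to_fract u"
      using Gamma0_hom[OF hom] Gamma0_subset_polynomials unfolding K_def by blast
    have u0: "u \<noteq> 0" using u hom_eq_0_iff[of ratX] by (auto simp: ratX_nonzero)
    have "total_degree u \<noteq> 0"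
    proof
      assume "total_degree u = 0"
      then obtain c where "u = [:[:c:]:]" using total_degree_eq_0 by blast
      hence "\<phi> ratX = \<phi> (rconst c)" using u unfolding hom_const by (simp add: rconst_def)
      thus False using injD[OF hom_inj] ratX_not_const by blast
    qed
    moreover have "M ratX = - int (total_degree u)"
      using fun_cong[OF M(2), of ratX] u u0 by (simp add: ext_val_def ratX_nonzero fract_val_to_fract)
    ultimately have neg: "M ratX < 0" by simp
    have "int (Polynomial.degree p) * 1 \<le> int (Polynomial.degree p) * (- M ratX)"
      using neg by (intro mult_left_mono) auto
    thus ?thesis
      using degree_mult_le_weight[OF M(1)[unfolded K_def] neg p(1)] by simp
  qed
  have "poisson_isomorphic K (KP (to_fract (xy_poly p)))"
    unfolding poisson_isomorphic_def poisson_iso_def K_def to_fract_xy_poly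
    by (intro exI[of _ id]) (simp add: poisson_hom_def)
  hence "fht K \<le> enat (Polynomial.degree p + 2)"
    unfolding fht_def by (intro INF_lower2[of "xy_poly p"]) (simp_all add: total_degree_xy_poly p)
  moreover have "enat (Polynomial.degree p + 2) \<le> fht K"
    unfolding fht_def using lower by (intro INF_greatest) auto
  ultimately show ?thesis unfolding K_def by (rule antisym)
qed

section \<open>Logarithmic derivatives with respect to \<open>y\<close>\<close>

text \<open>Upper bounds on the degrees suffice: if one is not attained, both sides are zero. This
  matters because \<open>y\<close> times a \<open>y\<close>-derivative can drop in degree.\<close>

lemma coeff_mult_top:
  fixes a b :: "'a::idom poly"
  assumes "Polynomial.degree a \<le> m" "Polynomial.degree b \<le> n"
  shows "Polynomial.coeff (a * b) (m + n) = Polynomial.coeff a m * Polynomial.coeff b n"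
proof (cases "Polynomial.degree a = m \<and> Polynomial.degree b = n")
  case True
  thus ?thesis using coeff_mult_degree_sum[of a b] by simp
next
  case False
  have "Polynomial.degree (a * b) \<le> Polynomial.degree a + Polynomial.degree b" by (rule degree_mult_le)
  also have "\<dots> < m + n" using assms False by linarith
  finally have "Polynomial.coeff (a * b) (m + n) = 0" by (rule coeff_eq_0)
  moreover have "Polynomial.coeff a m = 0 \<or> Polynomial.coeff b n = 0"
    using assms False coeff_eq_0[of a m] coeff_eq_0[of b n] by linarith
  ultimately show ?thesis by auto
qed

text \<open>
  Comparing leading coefficients: a logarithmic derivative \<open>y \<partial>\<^sub>y(u/v) / (u/v)\<close> that does not
  depend on \<open>y\<close> is the integer \<open>deg u - deg v\<close>.
\<close>

lemma log_derivative_const: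
  fixes u v :: "'a::idom poly"
  assumes nz: "u \<noteq> 0" "v \<noteq> 0"
    and eq: "[:A:] * (u * v) = [:B:] * ([:0, 1:] * (pderiv u * v - u * pderiv v))"
  shows "A = B * of_int (int (Polynomial.degree u) - int (Polynomial.degree v))"
proof -
  define m n where "m = Polynomial.degree u" and "n = Polynomial.degree v"
  \<comment> \<open>\<open>y\<close> times the \<open>y\<close>-derivative is the Euler operator: it
    multiplies the coefficient of \<open>y^i\<close> by \<open>i\<close>.\<close>
  have coeff: "Polynomial.coeff ([:0, 1:] * pderiv w) i = of_nat i * Polynomial.coeff w i" for w :: "'a poly" and i
    by (cases i) (simp_all add: coeff_pderiv del: of_nat_Suc)
  have deg: "Polynomial.degree ([:0, 1:] * pderiv w) \<le> Polynomial.degree w" for w :: "'a poly"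
    by (rule degree_le) (simp only: coeff, simp add: coeff_eq_0)
  define U V where "U = [:0, 1:] * pderiv u" and "V = [:0, 1:] * pderiv v"
  have "Polynomial.coeff (U * v) (m + n) = of_nat m * Polynomial.coeff u m * Polynomial.coeff v n"
    unfolding U_def using deg by (subst coeff_mult_top) (simp_all only: m_def n_def coeff order_refl)
  moreover have "Polynomial.coeff (u * V) (m + n) = Polynomial.coeff u m * (of_nat n * Polynomial.coeff v n)"
    unfolding V_def using deg by (subst coeff_mult_top) (simp_all only: m_def n_def coeff order_refl)
  moreover have "Polynomial.smult A (u * v) = [:A:] * (u * v)" by simp
  hence "Polynomial.smult A (u * v) = Polynomial.smult B (U * v - u * V)"
    unfolding eq U_def V_def by (simp add: smult_diff_right mult.commute)
  from arg_cong[OF this, of "\<lambda>p. Polynomial.coeff p (m + n)"]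
  have "A * Polynomial.coeff (u * v) (m + n)
      = B * (Polynomial.coeff (U * v) (m + n) - Polynomial.coeff (u * V) (m + n))"
    by (simp only: coeff_smult coeff_diff)
  moreover have "Polynomial.coeff (u * v) (m + n) = Polynomial.coeff u m * Polynomial.coeff v n"
    by (simp add: m_def n_def coeff_mult_degree_sum)
  ultimately have "A * (Polynomial.coeff u m * Polynomial.coeff v n)
      = B * of_int (int m - int n) * (Polynomial.coeff u m * Polynomial.coeff v n)"
    by (simp add: algebra_simps)
  moreover have "Polynomial.coeff u m * Polynomial.coeff v n \<noteq> 0"
    using nz by (simp add: m_def n_def)
  ultimately show ?thesis by (simp add: m_def n_def)
qed

section \<open>Rational functions with vanishing y-derivative\<close>

lemma rconst_add: "rconst (c + d) = rconst c + rconst d"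
  by (simp add: rconst_def flip: to_fract_add)

lemma dy_xpoly: "dy (of_xpoly p) = 0" and dx_xpoly: "dx (of_xpoly p) = of_xpoly (pderiv p)"
  by (simp_all add: of_xpoly_def dy_to_fract dx_to_fract pderiv_pCons Polynomial.map_poly_pCons)

lemma dy_Y: "dy ratY = 1"
  by (simp add: ratY_def dy_to_fract pderiv_pCons)

lemma dy_divide:
  assumes "b \<noteq> 0"
  shows "dy (a / b) * (b * b) = dy a * b - a * dy b"
proof -
  have "dy c * (b * b) = dy (c * b) * b - c * b * dy b" for c
    by (simp add: dy_mult algebra_simps)
  from this[of "a / b"] show ?thesis using assms by simp
qed

text \<open>The case \<open>A = 0\<close>, \<open>B = 1\<close> of
  \<open>log_derivative_const\<close>; characteristic zero turns the vanishing image of the degree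
  difference into equality of degrees.\<close>

lemma dy_eq_0_Fract:
  fixes u v :: "'k::field_char_0 poly poly"
  assumes "dy (to_fract u / to_fract v) = 0" "u \<noteq> 0" "v \<noteq> 0"
  shows "Polynomial.degree u = Polynomial.degree v"
proof -
  have "to_fract (pderiv u * v - u * pderiv v) = 0"
    using dy_divide[of "to_fract v" "to_fract u"] assms by (simp add: dy_to_fract)
  hence "pderiv u * v - u * pderiv v = 0" by (simp only: to_fract_eq_0_iff)
  hence "(0 :: 'k poly) = 1 * of_int (int (Polynomial.degree u) - int (Polynomial.degree v))"
    using assms by (intro log_derivative_const) simp_all
  thus ?thesis by simp
qed

text \<open>Subtracting the quotient of the leading coefficients leaves an element with zero
  derivative. If it were nonzero, its numerator would have the degree of its denominator, but the
  top terms have cancelled.\<close>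

lemma dy_eq_0:
  fixes q :: "'k::field_char_0 ratfun"
  assumes q: "dy q = 0"
  shows "\<exists>a b. b \<noteq> 0 \<and> q = of_xpoly a / of_xpoly b"
proof -
  obtain u v where uv: "q = Fract u v" "v \<noteq> 0" by (cases q)
  hence q_eq: "q = to_fract u / to_fract v" by (simp add: Fract_conv_to_fract)
  define a b where "a = lead_coeff u" and "b = lead_coeff v"
  define r where "r = [:b:] * u - [:a:] * v"
  have b: "b \<noteq> 0" using uv by (simp add: b_def)
  have diff: "q - of_xpoly a / of_xpoly b = to_fract r / to_fract ([:b:] * v)"
    using b uv unfolding q_eq r_def of_xpoly_def to_fract_diff to_fract_mult by (simp add: field_simps)
  have "r = 0"
  proof (rule ccontr)
    assume r: "r \<noteq> 0"
    have u: "u \<noteq> 0" using r by (auto simp: r_def a_def)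
    have deg: "Polynomial.degree u = Polynomial.degree v"
      using dy_eq_0_Fract[of u v] q u uv by (simp add: q_eq)
    have "dy (of_xpoly a / of_xpoly b) = 0"
      using dy_divide[of "of_xpoly b" "of_xpoly a"] b by (simp add: dy_xpoly of_xpoly_eq_0_iff)
    hence "dy (to_fract r / to_fract ([:b:] * v)) = 0"
      unfolding diff[symmetric] by (simp add: dy_diff q)
    hence "Polynomial.degree r = Polynomial.degree ([:b:] * v)"
      using r b uv by (intro dy_eq_0_Fract) auto
    hence "Polynomial.degree r = Polynomial.degree v" using b by simp
    hence "lead_coeff r = 0" by (simp add: r_def a_def b_def deg mult.commute)
    thus False using r by simp
  qed
  hence "q = of_xpoly a / of_xpoly b" using diff by simp
  thus ?thesis using b by blast
qed

section \<open>Poisson homomorphisms between the fields \<open>K{p(x)xy}\<close>\<close>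

text \<open>
  An affine map \<open>w \<mapsto> \<alpha>w + \<beta>\<close> permuting a finite set with at least two elements multiplies the
  nonzero product of the differences of its elements by a power of \<open>\<alpha>\<close>.
\<close>

lemma affine_permutation_root_of_unity:
  fixes \<alpha> \<beta> :: "'a::field"
  assumes fin: "finite Z" and map: "\<And>w. w \<in> Z \<Longrightarrow> \<alpha> * w + \<beta> \<in> Z" and \<alpha>: "\<alpha> \<noteq> 0"
    and two: "x \<in> Z" "y \<in> Z" "x \<noteq> y"
  shows "\<exists>N>0. \<alpha> ^ N = 1"
proof -
  define P where "P = {(u, v). u \<in> Z \<and> v \<in> Z \<and> u \<noteq> v}"
  define \<sigma> where "\<sigma> w = \<alpha> * w + \<beta>" for w
  have "P \<subseteq> Z \<times> Z" by (auto simp: P_def)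
  hence finP: "finite P" using fin by (meson finite_SigmaI finite_subset)
  have inj: "inj_on (map_prod \<sigma> \<sigma>) P"
    using \<alpha> by (auto simp: inj_on_def \<sigma>_def)
  have "map_prod \<sigma> \<sigma> z \<in> P" if "z \<in> P" for z
    using that \<alpha> map[of "fst z"] map[of "snd z"] by (cases z) (simp add: P_def \<sigma>_def)
  hence "map_prod \<sigma> \<sigma> ` P \<subseteq> P" by (rule image_subsetI)
  hence img: "map_prod \<sigma> \<sigma> ` P = P" using finP inj by (intro endo_inj_surj)
  have "(\<Prod>(u, v)\<in>P. u - v) = (\<Prod>(u, v)\<in>map_prod \<sigma> \<sigma> ` P. u - v)" by (simp only: img)
  also have "\<dots> = (\<Prod>(u, v)\<in>P. \<alpha> * (u - v))"
    by (subst prod.reindex[OF inj]) (auto intro!: prod.cong simp: \<sigma>_def algebra_simps)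
  also have "\<dots> = \<alpha> ^ card P * (\<Prod>(u, v)\<in>P. u - v)"
    by (simp add: case_prod_unfold prod.distrib)
  finally have "\<alpha> ^ card P = 1"
    using finP by (auto simp: P_def prod_zero_iff)
  moreover have "card P > 0"
    using finP two by (auto simp: card_gt_0_iff P_def)
  ultimately show ?thesis by blast
qed

lemma of_int_power_eq_1:
  assumes "(of_int n :: 'a::field_char_0) ^ N = 1" "N > 0"
  shows "n = 1 \<or> n = -1"
proof -
  have "of_int (n ^ N) = (of_int 1 :: 'a)" using assms by simp
  hence "n ^ N = 1" by (simp only: of_int_eq_iff)
  hence "\<bar>n\<bar> ^ N = 1 ^ N" by (simp flip: power_abs)
  hence "\<bar>n\<bar> = 1" using assms(2) power_eq_iff_eq_base[of N "\<bar>n\<bar>" 1] by simp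
  thus ?thesis by linarith
qed

section \<open>The images of the two variables under a homomorphism\<close>

locale xy_homomorphism = poisson_homomorphism "of_xpoly p1 * ratX * ratY" "of_xpoly p2 * ratX * ratY" \<phi>
  for p1 p2 :: "'k::field_char_0 poly" and \<phi> +
  assumes p1: "p1 \<noteq> 0" "Polynomial.degree p1 \<ge> 2"
    and p2: "p2 \<noteq> 0" "Polynomial.degree p2 \<le> Polynomial.degree p1"
begin

text \<open>Absorbing the factor \<open>x\<close> turns the brackets into
  \<open>{x, y} = q1(x) y\<close> and \<open>{x, y} = q2(x) y\<close>.\<close>

definition q1 :: "'k poly" where "q1 = pCons 0 p1"
definition q2 :: "'k poly" where "q2 = pCons 0 p2"

lemma q_nonzero: "q1 \<noteq> 0" "q2 \<noteq> 0"
  using p1 p2 by (simp_all add: q1_def q2_def)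

lemma degree_q: "Polynomial.degree q1 = Suc (Polynomial.degree p1)"
    "Polynomial.degree q2 = Suc (Polynomial.degree p2)"
  using p1 p2 by (simp_all add: q1_def q2_def)

lemma of_xpoly_q: "of_xpoly q1 = of_xpoly p1 * ratX" "of_xpoly q2 = of_xpoly p2 * ratX"
  by (simp_all add: q1_def q2_def of_xpoly_pCons)

definition g :: "'k poly" where
  "g = (SOME g. \<phi> ratX = of_xpoly g)"

text \<open>\<open>x\<close> is 1-integral in the source, so its image is 1-integral in the target,
  where such elements lie in \<open>k[x]\<close>.\<close>

lemma hom_X: "\<phi> ratX = of_xpoly g"
proof -
  have "ratX \<in> Gamma0 1 (KP (of_xpoly p1 * ratX * ratY))"
    unfolding Gamma0_xy[OF p1] using of_xpoly_X by (metis rangeI)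
  hence "\<exists>g. \<phi> ratX = of_xpoly g" using Gamma0_hom[OF hom] Gamma0_xy_subset by blast
  thus ?thesis unfolding g_def by (rule someI_ex)
qed

lemma degree_g: "Polynomial.degree g > 0"
proof (rule ccontr)
  assume "\<not> ?thesis"
  then obtain c where "g = [:c:]" by (auto elim: degree_eq_zeroE)
  hence "\<phi> ratX = \<phi> (rconst c)" by (simp add: hom_X of_xpoly_const hom_const)
  thus False using injD[OF hom_inj] ratX_not_const by blast
qed

text \<open>Apply \<phi> to \<open>{x, y} = q1(x) y\<close>. As \<open>\<phi> ratX\<close> is free
  of \<open>y\<close>, only the product of its \<open>x\<close>-derivative with the
  \<open>y\<close>-derivative of \<open>\<phi> ratY\<close> survives in the bracket.\<close>

lemma hom_Y_equation:
  "of_xpoly (pcompose q1 g) * \<phi> ratY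
     = of_xpoly (pderiv g * q2) * (ratY * dy (\<phi> ratY))"
proof -
  have "of_xpoly (pcompose q1 g) * \<phi> ratY = \<phi> (of_xpoly p1 * ratX * ratY)"
    by (simp only: hom_mult hom_xpoly[OF hom_X, symmetric] of_xpoly_q)
  also have "\<dots> = \<phi> (brk (KP (of_xpoly p1 * ratX * ratY)) ratX ratY)"
    by (simp only: brk_KP_X_Y)
  also have "\<dots> = of_xpoly (pderiv g) * dy (\<phi> ratY) * (of_xpoly p2 * ratX * ratY)"
    unfolding hom_brk by (simp add: brk_KP hom_X dx_xpoly dy_xpoly)
  also have "\<dots> = of_xpoly (pderiv g * q2) * (ratY * dy (\<phi> ratY))"
    by (simp add: of_xpoly_hom of_xpoly_q algebra_simps)
  finally show ?thesis .
qed

text \<open>Clearing denominators in \<open>hom_Y_equation\<close> gives the hypothesis of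
  \<open>log_derivative_const\<close>; the integer is the \<open>y\<close>-degree of
  \<open>\<phi> ratY\<close>.\<close>

lemma pcompose_g: "\<exists>n. pcompose q1 g = Polynomial.smult (of_int n) (pderiv g * q2)"
proof -
  obtain u v where uv: "\<phi> ratY = Fract u v" "v \<noteq> 0" by (cases "\<phi> ratY")
  hence Y: "\<phi> ratY = to_fract u / to_fract v" by (simp add: Fract_conv_to_fract)
  hence u: "u \<noteq> 0" using hom_eq_0_iff[of ratY] by (auto simp: ratY_nonzero)
  define A B where "A = pcompose q1 g" and "B = pderiv g * q2"
  have "of_xpoly A * \<phi> ratY * (to_fract v * to_fract v)
      = of_xpoly B * (ratY * (dy (\<phi> ratY) * (to_fract v * to_fract v)))"
    using hom_Y_equation by (simp add: A_def B_def mult.assoc)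
  also have "dy (\<phi> ratY) * (to_fract v * to_fract v) = to_fract (pderiv u * v - u * pderiv v)"
    unfolding Y using uv by (subst dy_divide) (simp_all add: dy_to_fract)
  also have "of_xpoly A * \<phi> ratY * (to_fract v * to_fract v) = to_fract ([:A:] * (u * v))"
    unfolding Y of_xpoly_def to_fract_mult using uv by simp
  finally have "[:A:] * (u * v) = [:B:] * ([:0, 1:] * (pderiv u * v - u * pderiv v))"
    unfolding of_xpoly_def ratY_def to_fract_mult[symmetric] to_fract_eq_iff .
  hence "A = B * of_int (int (Polynomial.degree u) - int (Polynomial.degree v))"
    by (rule log_derivative_const[OF u uv(2)])
  hence "A = Polynomial.smult (of_int (int (Polynomial.degree u) - int (Polynomial.degree v))) B"
    by (simp only: of_int_poly) simp
  thus ?thesis unfolding A_def B_def by blast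
qed

definition n :: int where
  "n = (SOME n. pcompose q1 g = Polynomial.smult (of_int n) (pderiv g * q2))"

lemma pcompose_g_n: "pcompose q1 g = Polynomial.smult (of_int n) (pderiv g * q2)"
  unfolding n_def by (rule someI_ex) (rule pcompose_g)

lemma pcompose_nonzero: "pcompose q1 g \<noteq> 0"
  using q_nonzero degree_g by (auto simp: pcompose_eq_0_iff)

lemma n_nonzero: "n \<noteq> 0"
  using pcompose_nonzero unfolding pcompose_g_n by auto

text \<open>With \<open>d1\<close>, \<open>d2\<close> the degrees of \<open>p1\<close>,
  \<open>p2\<close>, \<open>pcompose_g_n\<close> gives
  \<open>(d1 + 1) deg g = (deg g - 1) + (d2 + 1)\<close>.\<close>

lemma degree_equation: "Polynomial.degree p1 * Polynomial.degree g = Polynomial.degree p2"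
proof -
  have "pderiv g \<noteq> 0" using degree_g by (simp add: pderiv_eq_0_iff)
  hence "Polynomial.degree (pcompose q1 g) = Polynomial.degree g - 1 + Polynomial.degree q2"
    unfolding pcompose_g_n using n_nonzero q_nonzero by (simp add: degree_mult_eq degree_pderiv)
  thus ?thesis using degree_g by (simp add: degree_pcompose degree_q algebra_simps)
qed

lemma degree_eqs: "Polynomial.degree g = 1" "Polynomial.degree p1 = Polynomial.degree p2"
proof -
  have "Polynomial.degree p1 * Polynomial.degree g \<le> Polynomial.degree p1 * 1"
    using degree_equation p2 by simp
  hence "Polynomial.degree g \<le> 1" using p1 by (subst (asm) mult_le_cancel1) auto
  thus "Polynomial.degree g = 1" using degree_g by simp
  thus "Polynomial.degree p1 = Polynomial.degree p2" using degree_equation by simp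
qed

definition \<alpha> :: 'k where "\<alpha> = Polynomial.coeff g 1"
definition \<beta> :: 'k where "\<beta> = Polynomial.coeff g 0"

lemma g_eq: "g = [:\<beta>, \<alpha>:]"
  by (rule poly_eqI) (auto simp: \<alpha>_def \<beta>_def coeff_pCons degree_eqs coeff_eq_0 split: nat.splits)

lemma \<alpha>_nonzero: "\<alpha> \<noteq> 0"
  unfolding \<alpha>_def degree_eqs(1)[symmetric] using degree_g by (intro leading_coeff_neq_0) auto

lemma hom_X_affine: "\<phi> ratX = rconst \<alpha> * ratX + rconst \<beta>"
  by (simp add: hom_X g_eq of_xpoly_pCons of_xpoly_hom mult.commute add.commute)

lemma X_in_range: "ratX \<in> range \<phi>"
proof -
  have "\<phi> ((ratX - rconst \<beta>) / rconst \<alpha>) = ratX"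
    using \<alpha>_nonzero by (simp add: hom_divide hom_diff hom_const hom_X_affine rconst_eq_0_iff)
  thus ?thesis by (metis rangeI)
qed

text \<open>Cancelling \<open>g' q2\<close> exhibits \<open>\<phi> ratY\<close> as an eigenvector of
  the Euler operator in \<open>y\<close> with eigenvalue \<open>n\<close>.\<close>

lemma hom_Y_log_derivative: "ratY * dy (\<phi> ratY) = rconst (of_int n) * \<phi> ratY"
proof -
  define B where "B = pderiv g * q2"
  have B: "of_xpoly B \<noteq> 0" using pcompose_nonzero unfolding B_def pcompose_g_n of_xpoly_eq_0_iff by auto
  have "of_xpoly (Polynomial.smult (of_int n) B) = rconst (of_int n) * of_xpoly B"
    using of_xpoly_hom(2)[of "[:of_int n:]" B] by (simp add: of_xpoly_const)
  thus ?thesis using hom_Y_equation B unfolding pcompose_g_n B_def[symmetric] by simp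
qed

text \<open>The element \<open>c = \<phi>(y) y^(-n)\<close> has zero \<open>y\<close>-derivative, so
  it lies in \<open>k(x)\<close> and hence in the range. For \<open>n = 1\<close> or
  \<open>n = -1\<close>, \<open>y\<close> is a quotient of \<open>c\<close> and
  \<open>\<phi> ratY\<close>.\<close>

lemma Y_in_range:
  assumes "n = 1 \<or> n = -1"
  shows "ratY \<in> range \<phi>"
proof -
  define c where "c = (if n = 1 then \<phi> ratY / ratY else \<phi> ratY * ratY)"
  have Y0: "\<phi> ratY \<noteq> 0" using hom_eq_0_iff ratY_nonzero by blast
  have m1: "rconst (-1) = (-1 :: 'k ratfun)"
    using rconst_add[of 1 "-1"] by (simp add: add_eq_0_iff)
  have "dy c = 0"
  proof (cases "n = 1")
    case True
    hence "ratY * dy (\<phi> ratY) = \<phi> ratY" using hom_Y_log_derivative by simp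
    hence "dy (\<phi> ratY / ratY) * (ratY * ratY) = 0"
      by (subst dy_divide) (simp_all add: ratY_nonzero dy_Y mult.commute)
    thus ?thesis using True ratY_nonzero by (auto simp: c_def)
  next
    case False
    hence "n = -1" using assms by simp
    hence "ratY * dy (\<phi> ratY) = - \<phi> ratY" using hom_Y_log_derivative by (simp add: m1)
    thus ?thesis using False by (simp add: c_def dy_mult dy_Y mult.commute)
  qed
  then obtain a b where ab: "b \<noteq> 0" "c = of_xpoly a / of_xpoly b" using dy_eq_0 by blast
  have xpoly: "of_xpoly p \<in> range \<phi>" for p
  proof (induction p)
    case 0
    show ?case using hom_0 by (metis of_xpoly_hom(3) rangeI)
  next
    case (pCons a p)
    then obtain r s where "of_xpoly p = \<phi> r" "ratX = \<phi> s" using X_in_range by blast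
    hence "of_xpoly (pCons a p) = \<phi> (rconst a + s * r)"
      by (simp add: of_xpoly_pCons hom_add hom_mult hom_const)
    thus ?case by blast
  qed
  obtain a' b' where a'b': "of_xpoly a = \<phi> a'" "of_xpoly b = \<phi> b'" using xpoly[of a] xpoly[of b] by blast
  hence c: "c = \<phi> (a' / b')" using ab by (simp add: hom_divide)
  have "ratY = (if n = 1 then \<phi> ratY / c else c / \<phi> ratY)"
    using Y0 ratY_nonzero by (simp add: c_def)
  also have "\<dots> = \<phi> (if n = 1 then ratY / (a' / b') else (a' / b') / ratY)"
    by (simp only: c hom_divide split: if_split) simp
  finally show ?thesis by (metis rangeI)
qed

text \<open>Here \<open>q1(g) = n \<alpha> q1\<close>, so \<open>g\<close> maps roots of
  \<open>q1\<close> to roots. The root 0, from the factor \<open>x\<close>, and \<open>z\<close> are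
  distinct, which makes \<alpha> a root of unity.\<close>

lemma n_eq_1_or_minus_1:
  assumes eq: "p2 = p1" and z: "z \<noteq> 0" "poly (map_poly to_ac p1) z = 0"
  shows "n = 1 \<or> n = -1"
proof -
  define Q where "Q = map_poly to_ac q1"
  have comp: "pcompose q1 g = Polynomial.smult (of_int n * \<alpha>) q1"
  proof -
    have "q2 = q1" unfolding q1_def q2_def by (simp only: eq)
    moreover have "pderiv g = [:\<alpha>:]" by (simp add: g_eq pderiv_pCons)
    ultimately show ?thesis unfolding pcompose_g_n by simp
  qed
  \<comment> \<open>Since \<open>q1\<close> has degree one more than \<open>p1\<close>, one factor
    \<alpha> cancels and \<open>n\<close> is \<alpha> to the power \<open>deg p1\<close>.\<close>
  have "lead_coeff q1 * \<alpha> ^ Polynomial.degree q1 = lead_coeff (pcompose q1 g)"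
    using lead_coeff_comp[OF degree_g] degree_eqs(1) by (simp add: \<alpha>_def)
  also have "\<dots> = of_int n * \<alpha> * lead_coeff q1"
    unfolding comp by (rule lead_coeff_smult)
  finally have "(lead_coeff q1 * \<alpha>) * \<alpha> ^ Polynomial.degree p1 = (lead_coeff q1 * \<alpha>) * of_int n"
    unfolding degree_q(1) power_Suc by (simp only: ac_simps)
  moreover have "lead_coeff q1 * \<alpha> \<noteq> 0"
    using q_nonzero \<alpha>_nonzero by simp
  ultimately have n: "\<alpha> ^ Polynomial.degree p1 = of_int n"
    by (simp only: mult_cancel_left simp_thms)
  have ac_hom: "poly (map_poly to_ac (r + s)) w = poly (map_poly to_ac r) w + poly (map_poly to_ac s) w"
    "poly (map_poly to_ac (r * s)) w = poly (map_poly to_ac r) w * poly (map_poly to_ac s) w" for r s :: "'k poly" and w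
    by (rule poly_map_poly_hom; simp)+
  have ac_pCons: "poly (map_poly to_ac (pCons a r)) w = to_ac a + w * poly (map_poly to_ac r) w" for a r w
    by (simp add: Polynomial.map_poly_pCons)
  have ac_pcompose: "poly (map_poly to_ac (pcompose r g)) w = poly (map_poly to_ac r) (to_ac \<alpha> * w + to_ac \<beta>)" for r w
  proof (induction r)
    case (pCons a r)
    have "poly (map_poly to_ac g) w = to_ac \<alpha> * w + to_ac \<beta>"
      by (simp add: g_eq ac_pCons mult.commute add.commute)
    thus ?case by (simp only: pcompose_pCons ac_hom ac_pCons pCons.IH) simp
  qed simp
  have Q_nz: "Q \<noteq> 0"
    unfolding Q_def using q_nonzero(1) by (auto simp: poly_eq_iff coeff_map_poly)
  have "\<exists>N>0. to_ac \<alpha> ^ N = 1"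
  proof (rule affine_permutation_root_of_unity)
    show "finite {w. poly Q w = 0}" by (rule poly_roots_finite[OF Q_nz])
    show "to_ac \<alpha> * w + to_ac \<beta> \<in> {w. poly Q w = 0}" if "w \<in> {w. poly Q w = 0}" for w
    proof -
      have "poly Q (to_ac \<alpha> * w + to_ac \<beta>) = poly (map_poly to_ac ([:of_int n * \<alpha>:] * q1)) w"
        unfolding Q_def ac_pcompose[symmetric] comp by simp
      also have "\<dots> = 0" using that unfolding ac_hom Q_def by simp
      finally show ?thesis by simp
    qed
    show "to_ac \<alpha> \<noteq> 0" using \<alpha>_nonzero by simp
    show "0 \<in> {w. poly Q w = 0}" "z \<in> {w. poly Q w = 0}" "0 \<noteq> z"
      using z by (auto simp: Q_def q1_def ac_pCons)
  qed
  \<comment> \<open>The embedding \<open>to_ac\<close> is injective, so the relation descends from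
    the algebraic closure to \<open>k\<close>.\<close>
  then obtain N where N: "N > 0" "\<alpha> ^ N = 1" by (metis to_ac_power to_ac_eq_1_iff)
  have "of_int n ^ N = (1 :: 'k)"
    using N(2) by (metis n power_mult mult.commute power_one)
  thus ?thesis using N(1) by (rule of_int_power_eq_1)
qed

lemma automorphism:
  assumes "p2 = p1" "z \<noteq> 0" "poly (map_poly to_ac p1) z = 0"
  shows "bij \<phi>"
  using hom_inj surj_if_generators[OF X_in_range Y_in_range[OF n_eq_1_or_minus_1[OF assms]]]
  by (rule bijI)

end

theorem proposition5p2:
  fixes p1 p2 :: "'k::field_char_0 poly"
  defines "K1 \<equiv> KP (of_xpoly p1 * ratX * ratY)"
    and "K2 \<equiv> KP (of_xpoly p2 * ratX * ratY)"
  assumes "p1 \<noteq> 0" and "p2 \<noteq> 0"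
    and "Polynomial.degree p1 \<ge> 2"
    and "Polynomial.degree p1 \<ge> Polynomial.degree p2"
  shows "Gamma0 1 K1 = range of_xpoly \<and>
    (\<forall>\<phi>. poisson_hom K1 K2 \<phi> \<longrightarrow>
      Polynomial.degree p1 = Polynomial.degree p2 \<and>
      (\<exists>\<alpha> \<beta>. \<alpha> \<noteq> 0 \<and> \<phi> ratX = rconst \<alpha> * ratX + rconst \<beta>) \<and>
      (p2 = p1 \<and> (\<exists>z :: 'k alg_closure. z \<noteq> 0 \<and> poly (map_poly to_ac p1) z = 0) \<longrightarrow>
        poisson_iso K1 K1 \<phi>) \<and>
      (vht 1 K1 = ereal_of_enat (fht K1) \<and> fht K1 = enat (Polynomial.degree p1 + 2)))"
proof (intro conjI allI impI)
  show "Gamma0 1 K1 = range of_xpoly"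
    unfolding K1_def using assms by (intro Gamma0_xy)
  show fht: "fht K1 = enat (Polynomial.degree p1 + 2)"
    unfolding K1_def using assms by (intro fht_xy)
  show "vht 1 K1 = ereal_of_enat (fht K1)"
    unfolding fht unfolding K1_def using assms by (subst vht_xy) simp_all
  fix \<phi> assume hom: "poisson_hom K1 K2 \<phi>"
  interpret xy_homomorphism p1 p2 \<phi>
    by unfold_locales (use assms hom in simp_all)
  show "Polynomial.degree p1 = Polynomial.degree p2" by (rule degree_eqs)
  show "\<exists>\<alpha> \<beta>. \<alpha> \<noteq> 0 \<and> \<phi> ratX = rconst \<alpha> * ratX + rconst \<beta>"
    using \<alpha>_nonzero hom_X_affine by blast
  assume "p2 = p1 \<and> (\<exists>z :: 'k alg_closure. z \<noteq> 0 \<and> poly (map_poly to_ac p1) z = 0)"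
  thus "poisson_iso K1 K1 \<phi>"
    using automorphism hom by (auto simp: poisson_iso_def K1_def K2_def)
qed

end
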